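(* For any $d\in(0,2)$, the pure point support $\mathbb{A}_{\mathrm{p.p.}}=\{x\in[0,1]:\pi_d(\{x\})>0\}$ of the limiting empirical marginal distribution $\pi_d$ of random $2$-SAT is $$\mathbb{A}_{\mathrm{p.p.}}=\mathbb{Q}\cap(0,1).$$ Moreover, for $d\in(0,1]$, $\pi_d$ is a discrete measure; for $d\in(1,2)$, $\pi_d$ has a non-trivial continuous part $\pi_{d,\mathrm{c}}$ with $\mathrm{supp}(\pi_{d,\mathrm{c}})=[0,1]$.
   Context: Random $2$-SAT: for an integer $n>1$ and $d>0$, let $\boldsymbol\Phi=\boldsymbol\Phi_n$ be a random $2$-SAT formula on Boolean variables $x_1,\dots,x_n$ with $\boldsymbol m\sim\mathrm{Po}(dn/2)$ clauses; given $\boldsymbol m$, each clause is drawn independently and uniformly from the set of all $4\binom n2$ possible clauses with two distinct variables (each of the two variables may appear negated or non-negated). Truth values are encoded as $+1$ (true) and $-1$ (false). $S(\boldsymbol\Phi)\subseteq\{\pm1\}^{\{x_1,\dots,x_n\}}$ is the set of satisfying assignments; if $S(\boldsymbol\Phi)\neq\emptyset$, $\mu_{\boldsymbol\Phi}$ is the uniform distribution on $S(\boldsymbol\Phi)$, and $\boldsymbol\sigma$ denotes a sample from $\mu_{\boldsymbol\Phi}$. For $d<2$ the formula is satisfiable with probability tending to $1$ as $n\to\infty$. The measure $\pi_d$: it is known that for every $0<d<2$ there is a probability distribution $\pi_d$ on $[0,1]$ such that the random probability measure $\pi_{\boldsymbol\Phi}=\frac1n\sum_{i=1}^n\delta_{\mu_{\boldsymbol\Phi}(\boldsymbol\sigma_{x_i}=1)}$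 converges to $\pi_d$ weakly in probability, i.e. $\lim_{n\to\infty}\mathbb{E}\left|\int_0^1 f\,d\pi_d-\int_0^1 f\,d\pi_{\boldsymbol\Phi}\right|=0$ for every continuous $f:[0,1]\to\mathbb{R}$. Equivalently (also known), $\pi_d$ is the weak limit $\lim_{\ell\to\infty}\mathrm{BP}_d^{(\ell)}(\delta_{1/2})$ of the $\ell$-fold iterates of the operator $\mathrm{BP}_d$ on Borel probability measures on $(0,1)$ which maps $\pi$ to the law of $$\frac{\prod_{i=1}^{\boldsymbol d^-}\boldsymbol\mu_{\pi,i}}{\prod_{i=1}^{\boldsymbol d^-}\boldsymbol\mu_{\pi,i}+\prod_{i=1}^{\boldsymbol d^+}\boldsymbol\mu_{\pi,i+\boldsymbol d^-}},$$ where $\boldsymbol d^+,\boldsymbol d^-\sim\mathrm{Po}(d/2)$ and $(\boldsymbol\mu_{\pi,i})_{i\ge1}$ are i.i.d. with law $\pi$, all independent (empty products equal $1$). For a measure $\nu$ on $[0,1]$, $\mathrm{supp}(\nu)=\{x\in[0,1]:\nu((x-\varepsilon,x+\varepsilon)\cap[0,1])>0\text{ for all }\varepsilon>0\}$. "Discrete" means purely atomic, i.e. concentrated on a countable set. The continuous part $\pi_{d,\mathrm c}$ is the atomless component in the unique decomposition of $\pi_d$ into a discrete measure and a measure without atoms; non-trivial means not the zero measure. *)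

theory Defs
  imports "HOL-Probability.Probability"
begin

section \<open>Random 2-SAT\<close>

text \<open>The literal \<open>(i, True)\<close> is \<open>x\<^sub>i\<close> and \<open>(i, False)\<close> is its negation. A clause is the
  (unordered) set of its two literals, so that \<open>clauses n\<close> has \<open>4 * (n choose 2)\<close> elements.\<close>

type_synonym literal = "nat \<times> bool"
type_synonym clause = "literal set"
type_synonym formula = "clause list"

definition clauses :: "nat \<Rightarrow> clause set" where
  "clauses n = {{(i, s), (j, t)} | i j s t. i \<in> {1..n} \<and> j \<in> {1..n} \<and> i \<noteq> j}"

definition random_formula :: "real \<Rightarrow> nat \<Rightarrow> formula pmf" where
  "random_formula d n =
     bind_pmf (poisson_pmf (d * real n / 2)) (\<lambda>m. replicate_pmf m (pmf_of_set (clauses n)))"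

definition assignments :: "nat \<Rightarrow> (nat \<Rightarrow> int) set" where
  "assignments n = {1..n} \<rightarrow>\<^sub>E {- 1, 1}"

definition lit_true :: "(nat \<Rightarrow> int) \<Rightarrow> literal \<Rightarrow> bool" where
  "lit_true \<sigma> l \<longleftrightarrow> \<sigma> (fst l) = (if snd l then 1 else - 1)"

definition sat_assignments :: "nat \<Rightarrow> formula \<Rightarrow> (nat \<Rightarrow> int) set" where
  "sat_assignments n \<Phi> = {\<sigma> \<in> assignments n. \<forall>C\<in>set \<Phi>. \<exists>l\<in>C. lit_true \<sigma> l}"

text \<open>Meaningful for satisfiable \<open>\<Phi>\<close> only.\<close>

definition marginal :: "nat \<Rightarrow> formula \<Rightarrow> nat \<Rightarrow> real" where
  "marginal n \<Phi> i = measure_pmf.prob (pmf_of_set (sat_assignments n \<Phi>)) {\<sigma>. \<sigma> i = 1}"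

text \<open>The law of the marginal of a uniformly random variable, i.e. the average of the \<open>n\<close> point
  masses at the marginals.\<close>

definition empirical_marginals :: "nat \<Rightarrow> formula \<Rightarrow> real pmf" where
  "empirical_marginals n \<Phi> = map_pmf (marginal n \<Phi>) (pmf_of_set {1..n})"

text \<open>Weak convergence in probability of the empirical marginal distribution. The empirical
  distribution does not exist for unsatisfiable formulas; they contribute zero to the expectation
  here. As the integrals are bounded and the formula is satisfiable with probability tending to one
  for \<open>d < 2\<close>, this choice does not affect the limit.\<close>

definition empirical_marginals_converge :: "real \<Rightarrow> real measure \<Rightarrow> bool" where
  "empirical_marginals_converge d \<pi> \<longleftrightarrow>
     (\<forall>f :: real \<Rightarrow> real. continuous_on {0..1} f \<longrightarrow>
        (\<lambda>n. measure_pmf.expectation (random_formula d n)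
           (\<lambda>\<Phi>. if sat_assignments n \<Phi> = {} then 0
                else \<bar>(LINT x:{0..1}|\<pi>. f x)
                      - (LINT x:{0..1}|measure_pmf (empirical_marginals n \<Phi>). f x)\<bar>))
        \<longlonglongrightarrow> 0)"


section \<open>Belief Propagation\<close>

text \<open>Probability measures on \<open>(0,1)\<close> are represented by Borel measures on the real line that give
  \<open>(0,1)\<close> full mass.\<close>

definition BP :: "real \<Rightarrow> real measure \<Rightarrow> real measure" where
  "BP d \<pi> =
     distr (measure_pmf (poisson_pmf (d / 2)) \<Otimes>\<^sub>M measure_pmf (poisson_pmf (d / 2))
              \<Otimes>\<^sub>M (\<Pi>\<^sub>M i\<in>(UNIV :: nat set). \<pi>))
       borel
       (\<lambda>(dplus, dminus, \<mu>).
          (\<Prod>i=1..dminus. \<mu> i) /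
          ((\<Prod>i=1..dminus. \<mu> i) + (\<Prod>i=1..dplus. \<mu> (i + dminus))))"

definition BP_limit :: "real \<Rightarrow> real measure \<Rightarrow> bool" where
  "BP_limit d \<pi> \<longleftrightarrow> weak_conv_m (\<lambda>l. (BP d ^^ l) (return borel (1 / 2))) \<pi>"


section \<open>Discrete and continuous parts of a measure\<close>

definition discrete_measure :: "real measure \<Rightarrow> bool" where
  "discrete_measure \<nu> \<longleftrightarrow> (\<exists>C. countable C \<and> C \<in> sets \<nu> \<and> emeasure \<nu> (space \<nu> - C) = 0)"

definition atomless :: "real measure \<Rightarrow> bool" where
  "atomless \<nu> \<longleftrightarrow> (\<forall>x. emeasure \<nu> {x} = 0)"

definition decomposition :: "real measure \<Rightarrow> real measure \<Rightarrow> real measure \<Rightarrow> bool" where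
  "decomposition \<nu> \<alpha> \<gamma> \<longleftrightarrow>
     sets \<alpha> = sets \<nu> \<and> sets \<gamma> = sets \<nu> \<and> discrete_measure \<alpha> \<and> atomless \<gamma> \<and>
     (\<forall>A\<in>sets \<nu>. emeasure \<nu> A = emeasure \<alpha> A + emeasure \<gamma> A)"

definition continuous_part :: "real measure \<Rightarrow> real measure" where
  "continuous_part \<nu> = (THE \<gamma>. \<exists>\<alpha>. decomposition \<nu> \<alpha> \<gamma>)"

definition nontrivial :: "real measure \<Rightarrow> bool" where
  "nontrivial \<nu> \<longleftrightarrow> emeasure \<nu> (space \<nu>) \<noteq> 0"

definition supp :: "real measure \<Rightarrow> real set" where
  "supp \<nu> = {x \<in> {0..1}. \<forall>\<epsilon>>0. emeasure \<nu> ({x - \<epsilon> <..< x + \<epsilon>} \<inter> {0..1}) > 0}"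

definition pure_point_support :: "real measure \<Rightarrow> real set" where
  "pure_point_support \<nu> = {x \<in> {0..1}. emeasure \<nu> {x} > 0}"

text \<open>The continuous part is well defined for finite Borel measures.\<close>

lemma decomposition_unique:
  assumes fin: "finite_measure \<nu>" and sb: "sets \<nu> = sets borel"
    and 1: "decomposition \<nu> \<alpha> \<gamma>" and 2: "decomposition \<nu> \<alpha>' \<gamma>'"
  shows "\<gamma> = \<gamma>'"
proof (rule measure_eqI)
  show "sets \<gamma> = sets \<gamma>'" using 1 2 by (simp add: decomposition_def)
next
  fix A assume "A \<in> sets \<gamma>"
  hence A: "A \<in> sets \<nu>" using 1 by (simp add: decomposition_def)
  obtain C where C: "countable C" "C \<in> sets \<alpha>" "emeasure \<alpha> (space \<alpha> - C) = 0"
    using 1 by (auto simp: decomposition_def discrete_measure_def)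
  obtain C' where C': "countable C'" "C' \<in> sets \<alpha>'" "emeasure \<alpha>' (space \<alpha>' - C') = 0"
    using 2 by (auto simp: decomposition_def discrete_measure_def)
  define B where "B = A - (C \<union> C')"
  have sa: "sets \<alpha> = sets \<nu>" "sets \<gamma> = sets \<nu>" "sets \<alpha>' = sets \<nu>" "sets \<gamma>' = sets \<nu>"
    using 1 2 by (auto simp: decomposition_def)
  have B: "B \<in> sets \<nu>" using A C(2) C'(2) sa by (auto simp: B_def)
  have null: "emeasure \<delta> (A \<inter> (C \<union> C')) = 0" if "atomless \<delta>" "sets \<delta> = sets \<nu>" for \<delta>
  proof -
    have c: "countable (A \<inter> (C \<union> C'))" using C(1) C'(1) by auto
    have "{x} \<in> null_sets \<delta>" for x
      using that sb by (auto simp: null_sets_def atomless_def)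
    hence "(\<Union>x\<in>A \<inter> (C \<union> C'). {x}) \<in> null_sets \<delta>"
      by (intro null_sets_UN'[OF c])
    thus ?thesis by (simp only: UN_singleton) (simp add: null_sets_def)
  qed
  have Acc: "A \<inter> (C \<union> C') \<in> sets \<nu>" using A C(2) C'(2) sa by auto
  have eqB: "emeasure \<delta> A = emeasure \<delta> B" if "atomless \<delta>" "sets \<delta> = sets \<nu>" for \<delta>
  proof -
    have "emeasure \<delta> (B \<union> (A \<inter> (C \<union> C'))) = emeasure \<delta> B"
      using null[OF that] B Acc that(2) by (intro emeasure_Un_null_set) (auto simp: null_sets_def)
    moreover have "B \<union> (A \<inter> (C \<union> C')) = A" by (auto simp: B_def)
    ultimately show ?thesis by simp
  qed
  have z: "emeasure \<alpha> B = 0"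
  proof -
    have "B \<subseteq> space \<alpha> - C" using sets.sets_into_space[OF B] sets_eq_imp_space_eq[OF sa(1)]
      by (auto simp: B_def)
    hence "emeasure \<alpha> B \<le> emeasure \<alpha> (space \<alpha> - C)" using C(2) by (intro emeasure_mono) auto
    thus ?thesis using C(3) by simp
  qed
  have z': "emeasure \<alpha>' B = 0"
  proof -
    have "B \<subseteq> space \<alpha>' - C'" using sets.sets_into_space[OF B] sets_eq_imp_space_eq[OF sa(3)]
      by (auto simp: B_def)
    hence "emeasure \<alpha>' B \<le> emeasure \<alpha>' (space \<alpha>' - C')" using C'(2) by (intro emeasure_mono) auto
    thus ?thesis using C'(3) by simp
  qed
  have "emeasure \<gamma> B = emeasure \<nu> B" using 1 B z by (simp add: decomposition_def)
  also have "\<dots> = emeasure \<gamma>' B" using 2 B z' by (simp add: decomposition_def)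
  finally show "emeasure \<gamma> A = emeasure \<gamma>' A"
    using eqB[of \<gamma>] eqB[of \<gamma>'] 1 2 sa by (simp add: decomposition_def)
qed

lemma decomposition_exists:
  assumes fin: "finite_measure \<nu>" and sb: "sets \<nu> = sets borel"
  shows "\<exists>\<alpha> \<gamma>. decomposition \<nu> \<alpha> \<gamma>"
proof -
  interpret finite_measure \<nu> by fact
  have sp: "space \<nu> = UNIV" using sets_eq_imp_space_eq[OF sb] by simp
  define C where "C = {x. measure \<nu> {x} \<noteq> 0}"
  have cC: "countable C" unfolding C_def by (rule countable_support)
  hence C: "C \<in> sets \<nu>" using sb by (simp add: sets.countable)
  define \<alpha> where "\<alpha> = density \<nu> (indicator C)"
  define \<gamma> where "\<gamma> = density \<nu> (indicator (- C))"
  have C': "- C \<in> sets \<nu>" using C sp by (metis Compl_eq_Diff_UNIV sets.compl_sets)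
  have ea: "emeasure \<alpha> A = emeasure \<nu> (C \<inter> A)" if "A \<in> sets \<nu>" for A
    unfolding \<alpha>_def using that C by (simp add: emeasure_density indicator_inter_arith[symmetric])
  have eg: "emeasure \<gamma> A = emeasure \<nu> (- C \<inter> A)" if "A \<in> sets \<nu>" for A
    unfolding \<gamma>_def using that C' by (simp add: emeasure_density indicator_inter_arith[symmetric])
  have s: "sets \<alpha> = sets \<nu>" "sets \<gamma> = sets \<nu>" by (auto simp: \<alpha>_def \<gamma>_def)
  have "discrete_measure \<alpha>"
    unfolding discrete_measure_def
    using cC C C' ea[OF C'] sp by (intro exI[of _ C]) (simp add: s \<alpha>_def Compl_eq_Diff_UNIV[symmetric])
  moreover have "atomless \<gamma>"
    unfolding atomless_def
  proof
    fix x show "emeasure \<gamma> {x} = 0"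
      using eg[of "{x}"] sb by (cases "x \<in> C") (auto simp: C_def emeasure_eq_measure)
  qed
  moreover have "emeasure \<nu> A = emeasure \<alpha> A + emeasure \<gamma> A" if A: "A \<in> sets \<nu>" for A
  proof -
    have "emeasure \<nu> (C \<inter> A) + emeasure \<nu> (- C \<inter> A) = emeasure \<nu> ((C \<inter> A) \<union> (- C \<inter> A))"
      using A C C' by (intro plus_emeasure) auto
    moreover have "(C \<inter> A) \<union> (- C \<inter> A) = A" by auto
    ultimately show ?thesis using ea[OF A] eg[OF A] by simp
  qed
  ultimately show ?thesis using s by (auto simp: decomposition_def)
qed

lemma decomposition_continuous_part:
  assumes "finite_measure \<nu>" "sets \<nu> = sets borel"
  shows "\<exists>\<alpha>. decomposition \<nu> \<alpha> (continuous_part \<nu>)"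
proof -
  obtain \<alpha> \<gamma> where *: "decomposition \<nu> \<alpha> \<gamma>" using decomposition_exists[OF assms] by blast
  have "continuous_part \<nu> = \<gamma>" unfolding continuous_part_def
    using * decomposition_unique[OF assms] by (intro the_equality) blast+
  thus ?thesis using * by blast
qed

end

theory Submission
  imports Defs
begin

text \<open>
Pass to log-odds. If \<open>\<rho>\<close> is the law of \<open>L = ln (\<mu> / (1 - \<mu>))\<close> for \<open>\<mu> \<sim> \<pi>\<close>, then the fixed point
equation of Belief Propagation says that \<open>L\<close> is distributed as a compound Poisson sum: a
\<open>Po(d)\<close> number of independent jumps, each of them \<open>\<plusminus> ln (1 + exp (- L'))\<close> with a fair sign and
an independent copy \<open>L'\<close> of \<open>L\<close> (note \<open>- ln \<mu> = ln (1 + exp (- L))\<close>).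

That the weak limit \<open>\<pi>\<close> of the iterates satisfies this equation needs that \<open>\<pi>\<close> does not charge the
endpoints \<open>0\<close> and \<open>1\<close>, where the map is discontinuous. This is where \<open>d < 2\<close> first enters: the
defect \<open>1 - E[\<mu>\<^sup>t]\<close> is subadditive under products, so one step of the operator multiplies it by at
most \<open>d / 2 < 1\<close>, up to a small additive error (\<open>BP_powr_defect_le\<close>), and it stays small uniformly
in the number of iterations as \<open>t\<close> tends to \<open>0\<close> (\<open>unit_law_BP_limit\<close>). The equation is then
obtained by comparing characteristic functions (\<open>log_odds_law_fixed_point\<close>).

Let \<open>log_rats\<close> be the group of logarithms of positive rationals, which is the set of log-odds of
rational marginals. Four facts about \<open>\<rho>\<close> give the theorem.

\<^item> Every point of \<open>log_rats\<close> is an atom (\<open>log_rats_atom\<close>). The empty sum gives \<open>L = 0\<close>, and a single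
  jump sends the odds \<open>r\<close> to \<open>1 + 1 / r\<close> or to \<open>r / (1 + r)\<close>; by the Euclidean algorithm these two
  maps generate all positive rationals from \<open>1\<close>.

\<^item> \<open>r = \<rho> log_rats\<close> satisfies \<open>exp (d (r - 1)) \<le> r\<close>, since a sum of jumps in the group stays in the
  group. For \<open>d \<le> 1\<close> this forces \<open>r = 1\<close> (\<open>measure_log_rats_subcritical\<close>).

\<^item> The atoms come from finite trees only. In the Galton-Watson tree picture, let \<open>\<rho> = \<alpha> + \<beta>\<close> be the
  decomposition according to whether the tree is finite. A value \<open>L = x\<close> with an infinite tree
  requires a jump belonging to an infinite subtree. Given all other jumps, this jump must take one
  prescribed value; its sign is then determined, so this has probability at most half of the
  largest atom \<open>M\<close> of \<open>\<beta>\<close>. Summing over the on average \<open>d\<close> jumps, \<open>M \<le> (d / 2) M\<close>, whence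
  \<open>M = 0\<close>. Instead of trees, \<open>finite_tree_weights\<close> uses weights \<open>g\<close> on the atoms, the conditional
  probability given \<open>L\<close> that the tree is lower than a given height; these weights exhaust the
  atoms geometrically fast, live on \<open>log_rats\<close>, and have total mass at most any
  \<open>q\<close> with \<open>exp (d (q - 1)) \<le> q\<close>. Hence all atoms lie in \<open>log_rats\<close> (\<open>atom_imp_log_rats\<close>) and,
  taking \<open>q = 1 / d\<close>, \<open>r < 1\<close> for \<open>d > 1\<close> (\<open>measure_log_rats_supercritical\<close>).

\<^item> For \<open>d > 1\<close> the mass outside of \<open>log_rats\<close> is spread everywhere: adding an atom \<open>y \<in> log_rats\<close> to a
  jump outside of \<open>log_rats\<close> stays outside, and \<open>log_rats\<close> is dense (\<open>full_support_off_log_rats\<close>).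
\<close>

section \<open>Expectations of products over Poisson many independent factors\<close>

lemma integral_PiM_prod:
  fixes f :: "nat \<Rightarrow> 'a \<Rightarrow> complex"
  assumes M: "prob_space M" and I: "finite I" and f: "\<And>i. i \<in> I \<Longrightarrow> integrable M (f i)"
  shows "(\<integral>\<omega>. (\<Prod>i\<in>I. f i (\<omega> i)) \<partial>(\<Pi>\<^sub>M i\<in>UNIV. M)) = (\<Prod>i\<in>I. \<integral>x. f i x \<partial>M)"
proof -
  interpret M: prob_space M by fact
  interpret product_prob_space "\<lambda>_::nat. M" UNIV by unfold_locales
  have [measurable]: "f i \<in> borel_measurable M" if "i \<in> I" for i
    using f[OF that] by simp
  have "(\<Prod>i\<in>I. \<integral>x. f i x \<partial>M) = (\<integral>\<omega>. (\<Prod>i\<in>I. f i (\<omega> i)) \<partial>(\<Pi>\<^sub>M i\<in>I. M))"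
    by (rule product_integral_prod[symmetric]) (use I f in auto)
  also have "(\<Pi>\<^sub>M i\<in>I. M) = distr (\<Pi>\<^sub>M i\<in>UNIV. M) (\<Pi>\<^sub>M i\<in>I. M) (\<lambda>\<omega>. restrict \<omega> I)"
    by (rule distr_PiM_restrict_finite[symmetric]) (use I in auto)
  also have "(\<integral>\<omega>. (\<Prod>i\<in>I. f i (\<omega> i)) \<partial>\<dots>) = (\<integral>\<omega>. (\<Prod>i\<in>I. f i (\<omega> i)) \<partial>(\<Pi>\<^sub>M i\<in>UNIV. M))"
    by (subst integral_distr) (auto intro!: Bochner_Integration.integral_cong prod.cong)
  finally show ?thesis by simp
qed

lemma poisson_generating_function:
  fixes z :: complex
  assumes "0 < a"
  shows "(\<integral>k. z ^ k \<partial>measure_pmf (poisson_pmf a)) = exp (of_real a * (z - 1))"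
proof -
  have s: "(\<lambda>k. (of_real a * z) ^ k /\<^sub>R fact k) sums exp (of_real a * z)"
    by (rule exp_converges)
  have s': "(\<lambda>k. exp (- of_real a) * ((of_real a * z) ^ k /\<^sub>R fact k)) sums
      (exp (- of_real a) * exp (of_real a * z))"
    by (rule sums_mult[OF s])
  have eq: "pmf (poisson_pmf a) k *\<^sub>R z ^ k = exp (- of_real a) * ((of_real a * z) ^ k /\<^sub>R fact k)" for k
    using assms by (simp add: scaleR_conv_of_real exp_of_real[symmetric] power_mult_distrib field_simps del: exp_of_real)
  have "summable (\<lambda>k. (norm (of_real a * z)) ^ k /\<^sub>R fact k)"
    using exp_converges sums_summable by blast
  hence "summable (\<lambda>k. exp (-a) * ((norm (of_real a * z)) ^ k /\<^sub>R fact k))"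
    by (rule summable_mult)
  moreover have "norm (pmf (poisson_pmf a) k *\<^sub>R z ^ k) = exp (-a) * ((norm (of_real a * z)) ^ k /\<^sub>R fact k)" for k
    unfolding eq by (simp add: norm_mult norm_power exp_of_real[symmetric] flip: of_real_minus del: exp_of_real)
  ultimately have "integrable (count_space UNIV) (\<lambda>k. pmf (poisson_pmf a) k *\<^sub>R z ^ k)"
    by (simp add: integrable_count_space_nat_iff)
  from sums_integral_count_space_nat[OF this]
  have "(\<lambda>k. pmf (poisson_pmf a) k *\<^sub>R z ^ k) sums (\<integral>k. pmf (poisson_pmf a) k *\<^sub>R z ^ k \<partial>count_space UNIV)" .
  with s' have "(\<integral>k. pmf (poisson_pmf a) k *\<^sub>R z ^ k \<partial>count_space UNIV) = exp (- of_real a) * exp (of_real a * z)"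
    by (intro sums_unique2[of "\<lambda>k. pmf (poisson_pmf a) k *\<^sub>R z ^ k"]) (simp_all only: eq)
  moreover have "(\<integral>k. z ^ k \<partial>measure_pmf (poisson_pmf a)) = (\<integral>k. pmf (poisson_pmf a) k *\<^sub>R z ^ k \<partial>count_space UNIV)"
    by (simp add: measure_pmf_eq_density integral_density)
  ultimately show ?thesis by (simp add: exp_add[symmetric] algebra_simps)
qed

abbreviation BP_space :: "real \<Rightarrow> real measure \<Rightarrow> (nat \<times> nat \<times> (nat \<Rightarrow> real)) measure" where
  "BP_space d m \<equiv> measure_pmf (poisson_pmf (d / 2)) \<Otimes>\<^sub>M measure_pmf (poisson_pmf (d / 2))
              \<Otimes>\<^sub>M (\<Pi>\<^sub>M i\<in>(UNIV :: nat set). m)"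

lemma prob_space_BP_space: "prob_space m \<Longrightarrow> prob_space (BP_space d m)"
  by (intro prob_space_pair prob_space_PiM prob_space_measure_pmf)

lemma measurable_BP_space:
  assumes "\<And>k l. (\<lambda>\<mu>. F (l, k, \<mu>)) \<in> measurable (\<Pi>\<^sub>M i\<in>(UNIV :: nat set). m) N"
  shows "F \<in> measurable (BP_space d m) N"
proof -
  have 1: "(\<lambda>p. F (l, p)) \<in> measurable (count_space UNIV \<Otimes>\<^sub>M (\<Pi>\<^sub>M i\<in>(UNIV :: nat set). m)) N" for l
    by (rule measurable_pair_measure_countable1) (use assms in auto)
  have "F \<in> measurable (count_space UNIV \<Otimes>\<^sub>M count_space UNIV \<Otimes>\<^sub>M (\<Pi>\<^sub>M i\<in>(UNIV :: nat set). m)) N"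
    by (rule measurable_pair_measure_countable1) (use 1 in auto)
  moreover have "sets (BP_space d m) = sets (count_space UNIV \<Otimes>\<^sub>M count_space UNIV \<Otimes>\<^sub>M (\<Pi>\<^sub>M i\<in>(UNIV :: nat set). m))"
    by (intro sets_pair_measure_cong sets_measure_pmf_count_space refl)
  ultimately show ?thesis using measurable_cong_sets by blast
qed

text \<open>Both the characteristic function of the log-odds and the power moments are expectations of this
form, as the messages enter the operator through two products only.\<close>

lemma integral_BP_space:
  fixes f g :: "real \<Rightarrow> complex"
  assumes d: "0 < d" and m: "prob_space m" "sets m = sets borel"
    and [measurable]: "f \<in> borel_measurable borel" "g \<in> borel_measurable borel"
    and f: "\<And>x. norm (f x) \<le> 1" and g: "\<And>x. norm (g x) \<le> 1"
  shows "(\<integral>(l, k, \<mu>). (\<Prod>i=1..k. f (\<mu> i)) * (\<Prod>i=1..l. g (\<mu> (i + k))) \<partial>BP_space d m) =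
     exp (of_real (d / 2) * ((\<integral>x. f x \<partial>m) - 1)) * exp (of_real (d / 2) * ((\<integral>x. g x \<partial>m) - 1))"
proof -
  let ?P = "measure_pmf (poisson_pmf (d / 2))" and ?S = "\<Pi>\<^sub>M i\<in>(UNIV :: nat set). m"
  let ?F = "\<lambda>l k (\<mu> :: nat \<Rightarrow> real). (\<Prod>i=1..k. f (\<mu> i)) * (\<Prod>i=1..l. g (\<mu> (i + k)))"
  interpret m: prob_space m by fact
  interpret S: prob_space ?S by (intro prob_space_PiM m)
  interpret P: prob_space ?P by (rule prob_space_measure_pmf)
  interpret PS: pair_prob_space ?P ?S ..
  interpret PPS: pair_prob_space ?P "?P \<Otimes>\<^sub>M ?S" ..
  note [measurable_cong] = m(2)
  have meas: "(\<lambda>(l, k, \<mu>). ?F l k \<mu>) \<in> borel_measurable (BP_space d m)"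
    by (rule measurable_BP_space) simp
  have meas2: "(\<lambda>(k, \<mu>). ?F l k \<mu>) \<in> borel_measurable (?P \<Otimes>\<^sub>M ?S)" for l
  proof -
    have "(\<lambda>(k, \<mu>). ?F l k \<mu>) \<in> borel_measurable (count_space UNIV \<Otimes>\<^sub>M ?S)"
      by (rule measurable_pair_measure_countable1) auto
    moreover have "sets (?P \<Otimes>\<^sub>M ?S) = sets (count_space UNIV \<Otimes>\<^sub>M ?S)"
      by (intro sets_pair_measure_cong sets_measure_pmf_count_space refl)
    ultimately show ?thesis using measurable_cong_sets by blast
  qed
  have bd: "norm (?F l k \<mu>) \<le> 1" for l k \<mu>
    unfolding norm_mult prod_norm[symmetric]
    by (intro mult_le_one prod_le_1 prod_nonneg conjI) (use f g in auto)
  have int3: "integrable (BP_space d m) (\<lambda>(l, k, \<mu>). ?F l k \<mu>)"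
    by (rule PPS.integrable_const_bound[where B=1, OF _ meas]) (use bd in auto)
  have int2: "integrable (?P \<Otimes>\<^sub>M ?S) (\<lambda>(k, \<mu>). ?F l k \<mu>)" for l
    by (rule PS.integrable_const_bound[where B=1, OF _ meas2]) (use bd in auto)
  have intf: "integrable m f" "integrable m g"
    using f g by (auto intro!: m.integrable_const_bound[where B=1])
  have inner: "(\<integral>\<mu>. ?F l k \<mu> \<partial>?S) = (\<integral>x. f x \<partial>m) ^ k * (\<integral>x. g x \<partial>m) ^ l" for k l
  proof -
    have "?F l k \<mu> = (\<Prod>i\<in>{1..k+l}. (if i \<le> k then f else g) (\<mu> i))" for \<mu>
    proof -
      have "{1..k+l} = {1..k} \<union> {k+1..k+l}" by auto
      hence "(\<Prod>i\<in>{1..k+l}. (if i \<le> k then f else g) (\<mu> i)) =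
        (\<Prod>i\<in>{1..k}. (if i \<le> k then f else g) (\<mu> i)) * (\<Prod>i\<in>{k+1..k+l}. (if i \<le> k then f else g) (\<mu> i))"
        by (simp add: prod.union_disjoint)
      also have "(\<Prod>i\<in>{k+1..k+l}. (if i \<le> k then f else g) (\<mu> i)) = (\<Prod>i=1..l. g (\<mu> (i + k)))"
        by (rule prod.reindex_bij_witness[of _ "\<lambda>i. i + k" "\<lambda>i. i - k"]) auto
      finally show ?thesis by simp
    qed
    hence "(\<integral>\<mu>. ?F l k \<mu> \<partial>?S) = (\<Prod>i\<in>{1..k+l}. \<integral>x. (if i \<le> k then f else g) x \<partial>m)"
      by (simp only:) (rule integral_PiM_prod, use m intf in auto)
    also have "\<dots> = (\<Prod>i\<in>{1..k+l}. if i \<le> k then (\<integral>x. f x \<partial>m) else (\<integral>x. g x \<partial>m))"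
      by (intro prod.cong) auto
    also have "{1..k+l} = {1..k} \<union> {k+1..k+l}" by auto
    also have "(\<Prod>i\<in>{1..k} \<union> {k+1..k+l}. if i \<le> k then (\<integral>x. f x \<partial>m) else (\<integral>x. g x \<partial>m)) =
       (\<integral>x. f x \<partial>m) ^ k * (\<integral>x. g x \<partial>m) ^ l"
      by (subst prod.union_disjoint) auto
    finally show ?thesis .
  qed
  have "(\<integral>p. (case p of (l, k, \<mu>) \<Rightarrow> ?F l k \<mu>) \<partial>BP_space d m) =
      (\<integral>l. (\<integral>p. (case p of (k, \<mu>) \<Rightarrow> ?F l k \<mu>) \<partial>(?P \<Otimes>\<^sub>M ?S)) \<partial>?P)"
    using PPS.integral_fst'[OF int3] by simp
  also have "\<dots> = (\<integral>l. (\<integral>k. (\<integral>\<mu>. ?F l k \<mu> \<partial>?S) \<partial>?P) \<partial>?P)"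
    using PS.integral_fst'[OF int2] by simp
  also have "\<dots> = (\<integral>l. (\<integral>k. (\<integral>x. f x \<partial>m) ^ k \<partial>?P) * (\<integral>x. g x \<partial>m) ^ l \<partial>?P)"
    unfolding inner by simp
  also have "\<dots> = (\<integral>k. (\<integral>x. f x \<partial>m) ^ k \<partial>?P) * (\<integral>l. (\<integral>x. g x \<partial>m) ^ l \<partial>?P)"
    by simp
  also have "\<dots> = exp (of_real (d / 2) * ((\<integral>x. f x \<partial>m) - 1)) * exp (of_real (d / 2) * ((\<integral>x. g x \<partial>m) - 1))"
    using d by (subst (1 2) poisson_generating_function) auto
  finally show ?thesis .
qed

section \<open>The limit of Belief Propagation does not charge the endpoints\<close>

definition unit_law :: "real measure \<Rightarrow> bool" where
  "unit_law m \<longleftrightarrow> real_distribution m \<and> (AE x in m. 0 < x \<and> x < 1)"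

definition BP_value :: "nat \<times> nat \<times> (nat \<Rightarrow> real) \<Rightarrow> real" where
  "BP_value = (\<lambda>(dplus, dminus, \<mu>).
          (\<Prod>i=1..dminus. \<mu> i) /
          ((\<Prod>i=1..dminus. \<mu> i) + (\<Prod>i=1..dplus. \<mu> (i + dminus))))"

lemma BP_eq: "BP d m = distr (BP_space d m) borel BP_value"
  unfolding BP_def BP_value_def ..

lemma measurable_BP_value [measurable]:
  assumes "sets m = sets borel"
  shows "BP_value \<in> borel_measurable (BP_space d m)"
proof (rule measurable_BP_space)
  note [measurable_cong] = assms
  show "(\<lambda>\<mu>. BP_value (l, k, \<mu>)) \<in> borel_measurable (\<Pi>\<^sub>M i\<in>(UNIV :: nat set). m)" for k l
    unfolding BP_value_def by simp
qed

lemma AE_BP_space: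
  assumes "unit_law m"
  shows "AE (l, k, \<mu>) in BP_space d m. \<forall>i. 0 < \<mu> i \<and> \<mu> i < 1"
proof -
  let ?P = "measure_pmf (poisson_pmf (d / 2))" and ?S = "\<Pi>\<^sub>M i\<in>(UNIV :: nat set). m"
  interpret m: real_distribution m using assms by (simp add: unit_law_def)
  interpret S: prob_space ?S by (intro prob_space_PiM m.prob_space_axioms)
  interpret P: prob_space ?P by (rule prob_space_measure_pmf)
  interpret PS: pair_prob_space ?P ?S ..
  interpret PPS: pair_prob_space ?P "?P \<Otimes>\<^sub>M ?S" ..
  have "AE \<mu> in ?S. \<forall>i. 0 < \<mu> i \<and> \<mu> i < 1"
    unfolding AE_all_countable
    using assms m.prob_space_axioms by (auto simp: unit_law_def intro!: AE_PiM_component)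
  hence "AE p in ?P \<Otimes>\<^sub>M ?S. \<forall>i. 0 < snd p i \<and> snd p i < 1"
    by (intro PS.AE_pair_measure) auto
  hence "AE p in BP_space d m. \<forall>i. 0 < snd (snd p) i \<and> snd (snd p) i < 1"
    by (intro PPS.AE_pair_measure) auto
  thus ?thesis by (simp add: case_prod_unfold)
qed

lemma BP_value_bounds:
  assumes "\<And>i. 0 < \<mu> i \<and> \<mu> i < (1::real)"
    and AB: "A = (\<Prod>i=1..k. \<mu> i)" "B = (\<Prod>i=1..l. \<mu> (i + k))"
  shows "0 < A" "A \<le> 1" "0 < B" "B \<le> 1" "BP_value (l, k, \<mu>) = A / (A + B)"
    and "0 < BP_value (l, k, \<mu>)" "BP_value (l, k, \<mu>) < 1"
    and "A / 2 \<le> BP_value (l, k, \<mu>)" "B / 2 \<le> 1 - BP_value (l, k, \<mu>)"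
proof -
  show A: "0 < A" "A \<le> 1" and B: "0 < B" "B \<le> 1"
    using assms(1) by (auto simp: AB less_imp_le intro!: prod_pos prod_le_1)
  show v: "BP_value (l, k, \<mu>) = A / (A + B)" by (simp add: BP_value_def AB)
  show "0 < BP_value (l, k, \<mu>)" "BP_value (l, k, \<mu>) < 1" unfolding v using A B by (auto simp: field_simps)
  have "A / (A + B) \<ge> A / 2" using A B by (intro divide_left_mono) auto
  thus "A / 2 \<le> BP_value (l, k, \<mu>)" by (simp add: v)
  have "B / 2 \<le> B / (A + B)" using A B by (intro divide_left_mono) auto
  also have "\<dots> = 1 - A / (A + B)" using A B by (simp add: field_simps)
  finally show "B / 2 \<le> 1 - BP_value (l, k, \<mu>)" by (simp add: v)
qed

lemma unit_law_BP:
  assumes "unit_law m"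
  shows "unit_law (BP d m)"
proof -
  interpret m: real_distribution m using assms by (simp add: unit_law_def)
  interpret Q: prob_space "BP_space d m" by (rule prob_space_BP_space) unfold_locales
  have [measurable]: "BP_value \<in> borel_measurable (BP_space d m)" by (rule measurable_BP_value) simp
  have "real_distribution (BP d m)"
    unfolding BP_eq real_distribution_def real_distribution_axioms_def
    by (auto intro!: Q.prob_space_distr)
  moreover have "AE x in BP d m. 0 < x \<and> x < 1"
    unfolding BP_eq
    by (subst AE_distr_iff) (use AE_BP_space[OF assms, of d] BP_value_bounds(6,7)[OF _ refl refl] in \<open>auto elim!: eventually_mono\<close>)
  ultimately show ?thesis by (simp add: unit_law_def)
qed

lemma unit_law_half: "unit_law (return borel (1 / 2))"
  by (auto simp: unit_law_def real_distribution_def real_distribution_axioms_def prob_space_return AE_return)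

lemma unit_law_BP_iterate: "unit_law ((BP d ^^ l) (return borel (1 / 2)))"
  by (induction l) (auto intro: unit_law_half unit_law_BP)

definition logit :: "real \<Rightarrow> real" where "logit x = ln (x / (1 - x))"

lemma measurable_logit [measurable]: "logit \<in> borel_measurable borel"
  unfolding logit_def by measurable

lemma iexp_ln_prod:
  assumes "finite I" "\<And>i. i \<in> I \<Longrightarrow> 0 < x i"
  shows "iexp (t * ln (\<Prod>i\<in>I. x i)) = (\<Prod>i\<in>I. iexp (t * ln (x i)))"
  using assms by (simp add: ln_prod sum_distrib_left exp_sum less_imp_neq[symmetric])

text \<open>The log-odds of the output are a difference of sums of logarithms of messages, so that the unit
complex exponential factorises over the messages.\<close>

lemma char_logit_BP:
  assumes d: "0 < d" and m: "unit_law m"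
  shows "(\<integral>x. iexp (t * logit x) \<partial>BP d m) =
    exp (of_real (d / 2) * ((\<integral>x. iexp (t * ln x) \<partial>m) - 1)) *
    exp (of_real (d / 2) * ((\<integral>x. iexp (- t * ln x) \<partial>m) - 1))"
proof -
  interpret m: real_distribution m using m by (simp add: unit_law_def)
  interpret Q: prob_space "BP_space d m" by (rule prob_space_BP_space) unfold_locales
  have [measurable]: "BP_value \<in> borel_measurable (BP_space d m)" by (rule measurable_BP_value) simp
  let ?F = "\<lambda>(l, k, \<mu>). (\<Prod>i=1..k. iexp (t * ln (\<mu> i))) * (\<Prod>i=1..l. iexp (- t * ln (\<mu> (i + k))))"
  have [measurable]: "?F \<in> borel_measurable (BP_space d m)"
    by (rule measurable_BP_space) simp
  have eq: "iexp (t * logit (BP_value (l, k, \<mu>))) = ?F (l, k, \<mu>)"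
    if \<mu>: "\<And>i. 0 < \<mu> i \<and> \<mu> i < 1" for l k and \<mu> :: "nat \<Rightarrow> real"
  proof -
    define A where "A = (\<Prod>i=1..k. \<mu> i)"
    define B where "B = (\<Prod>i=1..l. \<mu> (i + k))"
    note b = BP_value_bounds(1,3,5)[OF \<mu> A_def B_def]
    have "logit (BP_value (l, k, \<mu>)) = ln (A / B)"
    proof -
      have "1 - A / (A + B) = B / (A + B)"
        using b(1,2) by (simp add: field_simps)
      hence "(A / (A + B)) / (1 - A / (A + B)) = A / B"
        using b(1,2) by simp
      thus ?thesis by (simp only: logit_def b(3))
    qed
    also have "\<dots> = ln A - ln B" using b by (simp add: ln_div)
    finally have L: "logit (BP_value (l, k, \<mu>)) = ln A - ln B" .
    have "iexp (t * logit (BP_value (l, k, \<mu>))) = iexp (t * ln A) * iexp (- t * ln B)"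
      unfolding L by (simp add: exp_add[symmetric] algebra_simps)
    also have "iexp (t * ln A) = (\<Prod>i=1..k. iexp (t * ln (\<mu> i)))"
      unfolding A_def by (rule iexp_ln_prod) (use \<mu> in auto)
    also have "iexp (- t * ln B) = (\<Prod>i=1..l. iexp (- t * ln (\<mu> (i + k))))"
      unfolding B_def by (rule iexp_ln_prod) (use \<mu> in auto)
    finally show ?thesis by simp
  qed
  have "(\<integral>x. iexp (t * logit x) \<partial>BP d m) = (\<integral>p. iexp (t * logit (BP_value p)) \<partial>BP_space d m)"
    unfolding BP_eq by (subst integral_distr) auto
  also have "\<dots> = (\<integral>p. ?F p \<partial>BP_space d m)"
  proof (rule integral_cong_AE)
    show "AE p in BP_space d m. iexp (t * logit (BP_value p)) = ?F p"
      using AE_BP_space[OF m, of d]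
    proof eventually_elim
      case (elim p)
      obtain l k \<mu> where p: "p = (l, k, \<mu>)" by (cases p rule: prod_cases3)
      have "\<And>i. 0 < \<mu> i \<and> \<mu> i < 1" using elim by (simp add: p)
      thus ?case unfolding p by (rule eq)
    qed
  qed measurable
  also have "\<dots> = exp (of_real (d / 2) * ((\<integral>x. iexp (t * ln x) \<partial>m) - 1)) *
    exp (of_real (d / 2) * ((\<integral>x. iexp (- t * ln x) \<partial>m) - 1))"
    by (rule integral_BP_space[OF d]) (use m.prob_space_axioms in auto)
  finally show ?thesis .
qed

text \<open>The function \<open>x\<^sup>t\<close> on \<open>[0,1]\<close>, extended to a bounded continuous function on the line so that it
can be tested against weak convergence.\<close>

definition clamp_powr :: "real \<Rightarrow> real \<Rightarrow> real" where
  "clamp_powr t x = max 0 (min 1 x) powr t"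

lemma clamp_powr_bounds: "0 \<le> t \<Longrightarrow> 0 \<le> clamp_powr t x \<and> clamp_powr t x \<le> 1"
  by (auto simp: clamp_powr_def powr_le1)

lemma continuous_clamp_powr: "0 < t \<Longrightarrow> continuous_on UNIV (clamp_powr t)"
  unfolding clamp_powr_def
  by (rule continuous_on_powr') (auto intro!: continuous_intros)

lemma measurable_clamp_powr [measurable]: "clamp_powr t \<in> borel_measurable borel"
  unfolding clamp_powr_def by measurable

lemma (in real_distribution) integrable_clamp_powr:
  "0 < t \<Longrightarrow> f \<in> borel_measurable borel \<Longrightarrow> integrable M (\<lambda>x. clamp_powr t (f x))"
  using clamp_powr_bounds[of t] by (intro integrable_const_bound[where B=1]) auto

text \<open>The output is at least half of its numerator \<open>A\<close>, because the other product is at most \<open>1\<close>; its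
distance from \<open>1\<close> is in the same way at least half of the other product, whence the two cases. For
the numerator, \<open>E[A\<^sup>t] = exp (- (d / 2) (1 - E[\<mu>\<^sup>t])) \<ge> 1 - (d / 2) (1 - E[\<mu>\<^sup>t])\<close>. The halving costs
the additive term \<open>1 - 2\<^sup>-\<^sup>t\<close>, which vanishes as \<open>t\<close> tends to \<open>0\<close>.\<close>

lemma BP_powr_defect_le:
  assumes d: "0 < d" and t: "0 < t" and m: "unit_law m"
  shows "1 - (\<integral>x. clamp_powr t (if flip then 1 - x else x) \<partial>BP d m) \<le>
    (1 - 2 powr - t) + d / 2 * (1 - (\<integral>x. clamp_powr t x \<partial>m))"
proof -
  interpret m: real_distribution m using m by (simp add: unit_law_def)
  interpret Q: prob_space "BP_space d m" by (rule prob_space_BP_space) unfold_locales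
  have [measurable]: "BP_value \<in> borel_measurable (BP_space d m)" by (rule measurable_BP_value) simp
  let ?g = "\<lambda>x. if flip then 1 - x else (x::real)"
  let ?F = "\<lambda>(l, k, \<mu>). if flip then (\<Prod>i=1..l. clamp_powr t (\<mu> (i + k))) else (\<Prod>i=1..k. clamp_powr t (\<mu> i))"
  let ?f = "\<lambda>x. if flip then 1 else complex_of_real (clamp_powr t x)"
  let ?h = "\<lambda>x. if flip then complex_of_real (clamp_powr t x) else 1"
  define a where "a = (\<integral>x. clamp_powr t x \<partial>m)"
  have mF[measurable]: "?F \<in> borel_measurable (BP_space d m)"
    by (rule measurable_BP_space) simp
  have le: "2 powr - t * ?F (l, k, \<mu>) \<le> clamp_powr t (?g (BP_value (l, k, \<mu>)))"
    if \<mu>: "\<And>i. 0 < \<mu> i \<and> \<mu> i < 1" for l k and \<mu> :: "nat \<Rightarrow> real"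
  proof -
    define A where "A = (\<Prod>i=1..k. \<mu> i)"
    define B where "B = (\<Prod>i=1..l. \<mu> (i + k))"
    note b' = BP_value_bounds[OF \<mu> A_def B_def]
    have c: "clamp_powr t (\<mu> i) = \<mu> i powr t" for i using \<mu>[of i] by (simp add: clamp_powr_def)
    have "?F (l, k, \<mu>) = (if flip then B else A) powr t"
      using \<mu> by (auto simp: c A_def B_def prod_powr_distrib less_imp_le)
    hence "2 powr - t * ?F (l, k, \<mu>) = ((if flip then B else A) / 2) powr t"
      using b' by (auto simp: powr_divide powr_minus field_simps)
    also have "\<dots> \<le> ?g (BP_value (l, k, \<mu>)) powr t"
      using b' t by (intro powr_mono2) auto
    also have "\<dots> = clamp_powr t (?g (BP_value (l, k, \<mu>)))"
      using b' by (auto simp: clamp_powr_def)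
    finally show ?thesis .
  qed
  have F01: "norm (?F p) \<le> 1" for p
  proof -
    have "0 \<le> ?F p" "?F p \<le> 1"
      using clamp_powr_bounds[of t] t by (auto simp: split: prod.splits intro!: prod_nonneg prod_le_1)
    thus ?thesis by simp
  qed
  have "complex_of_real (\<integral>p. ?F p \<partial>BP_space d m) = (\<integral>p. complex_of_real (?F p) \<partial>BP_space d m)"
    by (rule integral_complex_of_real[symmetric])
  also have "\<dots> = (\<integral>(l, k, \<mu>). (\<Prod>i=1..k. ?f (\<mu> i)) * (\<Prod>i=1..l. ?h (\<mu> (i + k))) \<partial>BP_space d m)"
    by (intro Bochner_Integration.integral_cong) auto
  also have "\<dots> = exp (of_real (d / 2) * ((\<integral>x. ?f x \<partial>m) - 1)) * exp (of_real (d / 2) * ((\<integral>x. ?h x \<partial>m) - 1))"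
    using clamp_powr_bounds[of t] t by (intro integral_BP_space[OF d]) (auto intro: m.prob_space_axioms)
  also have "\<dots> = complex_of_real (exp (d / 2 * (a - 1)))"
    unfolding a_def using m.prob_space by (cases flip) (auto simp: exp_of_real[symmetric] simp del: exp_of_real)
  finally have EF: "(\<integral>p. ?F p \<partial>BP_space d m) = exp (d / 2 * (a - 1))"
    by (simp only: of_real_eq_iff)
  have iF: "integrable (BP_space d m) ?F"
    by (rule Q.integrable_const_bound[where B=1, OF _ mF], rule AE_I2, rule F01)
  have "2 powr - t * exp (d / 2 * (a - 1)) = (\<integral>p. 2 powr - t * ?F p \<partial>BP_space d m)"
    using EF by simp
  also have "\<dots> \<le> (\<integral>p. clamp_powr t (?g (BP_value p)) \<partial>BP_space d m)"
  proof (rule integral_mono_AE)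
    show "integrable (BP_space d m) (\<lambda>p. 2 powr - t * ?F p)" using iF by simp
    show "integrable (BP_space d m) (\<lambda>p. clamp_powr t (?g (BP_value p)))"
      using clamp_powr_bounds[of t] t by (intro Q.integrable_const_bound[where B=1]) auto
    show "AE p in BP_space d m. 2 powr - t * ?F p \<le> clamp_powr t (?g (BP_value p))"
      using AE_BP_space[OF m, of d] by eventually_elim (use le in auto)
  qed
  also have "\<dots> = (\<integral>x. clamp_powr t (?g x) \<partial>BP d m)"
    unfolding BP_eq by (subst integral_distr) auto
  finally have 1: "2 powr - t * exp (d / 2 * (a - 1)) \<le> (\<integral>x. clamp_powr t (?g x) \<partial>BP d m)" .
  have a1: "a \<le> 1" unfolding a_def
    using m.integrable_clamp_powr[OF t, of "\<lambda>x. x"] clamp_powr_bounds[of t] t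
    by (intro m.integral_le_const) auto
  have t1: "2 powr - t \<le> (1::real)" using t by (simp add: powr_minus field_simps ge_one_powr_ge_zero)
  have "2 powr - t * (1 + d / 2 * (a - 1)) \<le> 2 powr - t * exp (d / 2 * (a - 1))"
    by (intro mult_left_mono exp_ge_add_one_self) auto
  moreover have "2 powr - t * (1 + d / 2 * (a - 1)) = 2 powr - t - 2 powr - t * (d / 2 * (1 - a))"
    by (simp add: field_simps)
  ultimately have "1 - (\<integral>x. clamp_powr t (?g x) \<partial>BP d m) \<le> 1 - 2 powr - t + 2 powr - t * (d / 2 * (1 - a))"
    using 1 by linarith
  also have "2 powr - t * (d / 2 * (1 - a)) \<le> 1 * (d / 2 * (1 - a))"
    using t1 a1 d by (intro mult_right_mono) auto
  finally show ?thesis by (simp add: a_def)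
qed

text \<open>The bound is the fixed point of the affine contraction in the previous lemma. It is uniform in the
number of iterations, and therefore survives the passage to the weak limit.\<close>

lemma BP_iterate_powr_bound:
  assumes d: "0 < d" "d < 2" and t: "0 < t"
  defines "m \<equiv> \<lambda>l. (BP d ^^ l) (return borel (1 / 2))"
  shows "1 - (\<integral>x. clamp_powr t x \<partial>m l) \<le> (1 - 2 powr - t) / (1 - d / 2)"
    and "1 - (\<integral>x. clamp_powr t (1 - x) \<partial>m l) \<le> (1 - 2 powr - t) / (1 - d / 2)"
proof -
  define K where "K = (1 - 2 powr - t) / (1 - d / 2)"
  have t1: "2 powr - t \<le> (1::real)" using t by (simp add: powr_minus field_simps ge_one_powr_ge_zero)
  have K: "(1 - 2 powr - t) + d / 2 * K = K"
    using d by (simp add: K_def field_simps)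
  have K0: "1 - 2 powr - t \<le> K"
    unfolding K_def using d t1 by (simp add: field_simps mult_left_mono)
  have half: "clamp_powr t (1 / 2) = 2 powr - t"
    by (simp add: clamp_powr_def powr_divide powr_minus field_simps)
  \<comment> \<open>Both bounds are proved at once: the step for \<open>1 - x\<close> uses the bound for \<open>x\<close>.\<close>
  have "1 - (\<integral>x. clamp_powr t x \<partial>m l) \<le> K \<and> 1 - (\<integral>x. clamp_powr t (1 - x) \<partial>m l) \<le> K"
  proof (induction l)
    case 0
    show ?case using half K0 by (simp add: m_def integral_return)
  next
    case (Suc l)
    have u: "unit_law (m l)" unfolding m_def by (rule unit_law_BP_iterate)
    have "d / 2 * (1 - (\<integral>x. clamp_powr t x \<partial>m l)) \<le> d / 2 * K"
      using Suc d by (intro mult_left_mono) auto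
    thus ?case
      using BP_powr_defect_le[OF d(1) t u, of False] BP_powr_defect_le[OF d(1) t u, of True] K
      by (simp add: m_def)
  qed
  thus "1 - (\<integral>x. clamp_powr t x \<partial>m l) \<le> (1 - 2 powr - t) / (1 - d / 2)"
    and "1 - (\<integral>x. clamp_powr t (1 - x) \<partial>m l) \<le> (1 - 2 powr - t) / (1 - d / 2)"
    by (auto simp: K_def)
qed

text \<open>The indicator of \<open>0\<close> is at most \<open>1 - x\<^sup>t\<close>, for every \<open>t > 0\<close>; the expectation of the latter
is bounded by a quantity that tends to \<open>0\<close> with \<open>t\<close>. The endpoint \<open>1\<close> is treated by reflection.\<close>

lemma unit_law_BP_limit:
  assumes d: "0 < d" "d < 2" and p: "prob_space \<pi>" "sets \<pi> = sets borel" "emeasure \<pi> {0..1} = 1"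
    and lim: "BP_limit d \<pi>"
  shows "unit_law \<pi>"
proof -
  interpret real_distribution \<pi> using p by (simp add: real_distribution_def real_distribution_axioms_def)
  define m where "m = (\<lambda>l. (BP d ^^ l) (return borel (1 / 2)))"
  have m: "real_distribution (m l)" for l using unit_law_BP_iterate[of l d] by (simp add: m_def unit_law_def)
  have wc: "weak_conv_m m \<pi>" using lim by (simp add: BP_limit_def m_def)
  have null: "emeasure \<pi> {a} = 0" if g: "g = (\<lambda>x. x) \<and> a = 0 \<or> g = (\<lambda>x. 1 - x) \<and> a = 1" for a and g :: "real \<Rightarrow> real"
  proof -
    have cg: "continuous_on UNIV g" using g by (auto intro!: continuous_intros)
    have mg [measurable]: "g \<in> borel_measurable borel" using cg by (rule borel_measurable_continuous_onI)
    have bd: "measure \<pi> {a} \<le> (1 - 2 powr - t) / (1 - d / 2)" if t: "0 < t" for t :: real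
    proof -
      have c: "continuous_on UNIV (\<lambda>x. clamp_powr t (g x))"
        by (rule continuous_on_compose2[OF continuous_clamp_powr[OF t] cg]) auto
      have "(\<lambda>l. (\<integral>x. clamp_powr t (g x) \<partial>m l)) \<longlonglongrightarrow> (\<integral>x. clamp_powr t (g x) \<partial>\<pi>)"
        using c clamp_powr_bounds[of t] t
        by (intro weak_conv_imp_integral_bdd_continuous_conv[OF m real_distribution_axioms wc, where B=1])
           (auto simp: continuous_on_eq_continuous_at)
      hence "(\<lambda>l. 1 - (\<integral>x. clamp_powr t (g x) \<partial>m l)) \<longlonglongrightarrow> 1 - (\<integral>x. clamp_powr t (g x) \<partial>\<pi>)"
        by (intro tendsto_intros)
      hence K: "1 - (\<integral>x. clamp_powr t (g x) \<partial>\<pi>) \<le> (1 - 2 powr - t) / (1 - d / 2)"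
        by (rule LIMSEQ_le_const2) (use BP_iterate_powr_bound[OF d t] g in \<open>auto simp: m_def\<close>)
      have i: "integrable \<pi> (\<lambda>x. clamp_powr t (g x))" by (rule integrable_clamp_powr[OF t mg])
      have "measure \<pi> {a} = (\<integral>x. indicator {a} x \<partial>\<pi>)" by simp
      also have "\<dots> \<le> (\<integral>x. 1 - clamp_powr t (g x) \<partial>\<pi>)"
      proof (intro integral_mono)
        show "integrable \<pi> (indicator {a} :: real \<Rightarrow> real)" by (simp add: emeasure_eq_measure)
        show "indicator {a} x \<le> 1 - clamp_powr t (g x)" for x
          using g clamp_powr_bounds[of t "g x"] t by (auto simp: indicator_def clamp_powr_def split: if_splits)
      qed (use i in auto)
      also have "\<dots> = 1 - (\<integral>x. clamp_powr t (g x) \<partial>\<pi>)" using i prob_space by simp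
      finally show ?thesis using K by simp
    qed
    have "(\<lambda>n. (1 - 2 powr - (1 / real (Suc n))) / (1 - d / 2)) \<longlonglongrightarrow> (1 - 2 powr - 0) / (1 - d / 2)"
      using d by (intro tendsto_intros LIMSEQ_Suc[OF lim_1_over_n]) auto
    hence "measure \<pi> {a} \<le> (1 - 2 powr - 0) / (1 - d / 2)"
      by (rule LIMSEQ_le_const) (use bd in auto)
    thus ?thesis using measure_nonneg[of \<pi> "{a}"] by (simp add: emeasure_eq_measure)
  qed
  have "AE x in \<pi>. x \<in> {0..1}" using p(3) by (intro AE_prob_1) (simp add: emeasure_eq_measure)
  moreover have "AE x in \<pi>. x \<noteq> 0" using null[of "\<lambda>x. x" 0] by (subst AE_iff_measurable[of "{0}"]) auto
  moreover have "AE x in \<pi>. x \<noteq> 1" using null[of "\<lambda>x. 1 - x" 1] by (subst AE_iff_measurable[of "{1}"]) auto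
  ultimately have "AE x in \<pi>. 0 < x \<and> x < 1" by eventually_elim auto
  thus ?thesis by (simp add: unit_law_def real_distribution_axioms)
qed

text \<open>The functions that occur are discontinuous at the endpoints only, and these are null sets for the
limit, so both sides of the identity for the iterates converge.\<close>

lemma char_logit_BP_limit:
  assumes d: "0 < d" "d < 2" and u: "unit_law \<pi>" and lim: "BP_limit d \<pi>"
  shows "(\<integral>x. iexp (t * logit x) \<partial>\<pi>) =
    exp (of_real (d / 2) * ((\<integral>x. iexp (t * ln x) \<partial>\<pi>) - 1)) *
    exp (of_real (d / 2) * ((\<integral>x. iexp (- t * ln x) \<partial>\<pi>) - 1))"
proof -
  interpret real_distribution \<pi> using u by (simp add: unit_law_def)
  define m where "m = (\<lambda>l. (BP d ^^ l) (return borel (1 / 2)))"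
  have um: "unit_law (m l)" for l using unit_law_BP_iterate[of l d] by (simp add: m_def)
  have m: "real_distribution (m l)" for l using um by (simp add: unit_law_def)
  have wc: "weak_conv_m m \<pi>" using lim by (simp add: BP_limit_def m_def)
  have conv: "(\<lambda>l. \<integral>x. f x \<partial>m l) \<longlonglongrightarrow> (\<integral>x. f x \<partial>\<pi>)"
    if [measurable]: "f \<in> borel_measurable borel" and c: "\<And>x. 0 < x \<Longrightarrow> x < 1 \<Longrightarrow> isCont f x" and b: "\<And>x. norm (f x) \<le> 1"
    for f :: "real \<Rightarrow> complex"
  proof (rule weak_conv_imp_bdd_ae_continuous_conv[OF m real_distribution_axioms wc _ b])
    have [measurable]: "- {0<..<1::real} \<in> sets borel" by (intro borel_comp) simp
    have "AE x in \<pi>. x \<notin> - {0<..<1}" using u by (auto simp: unit_law_def elim!: eventually_mono)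
    hence "- {0<..<1} \<in> null_sets \<pi>" by (subst AE_iff_null_sets) auto
    hence "emeasure \<pi> (- {0<..<1}) = 0" by auto
    moreover have "emeasure \<pi> {x. \<not> isCont f x} \<le> emeasure \<pi> (- {0<..<1})"
      by (rule emeasure_mono) (use c in auto)
    ultimately show "emeasure \<pi> {x. \<not> isCont f x} = 0" by simp
  qed auto
  have "(\<lambda>l. \<integral>x. iexp (t * logit x) \<partial>m (Suc l)) \<longlonglongrightarrow> (\<integral>x. iexp (t * logit x) \<partial>\<pi>)"
    by (intro LIMSEQ_Suc conv) (auto simp: logit_def intro!: continuous_intros)
  also have "(\<lambda>l. \<integral>x. iexp (t * logit x) \<partial>m (Suc l)) = (\<lambda>l. 
    exp (of_real (d / 2) * ((\<integral>x. iexp (t * ln x) \<partial>m l) - 1)) *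
    exp (of_real (d / 2) * ((\<integral>x. iexp (- t * ln x) \<partial>m l) - 1)))"
    using char_logit_BP[OF d(1) um] by (simp add: m_def fun_eq_iff)
  finally have 1: "\<dots> \<longlonglongrightarrow> (\<integral>x. iexp (t * logit x) \<partial>\<pi>)" .
  have "(\<lambda>l. \<integral>x. iexp (s * ln x) \<partial>m l) \<longlonglongrightarrow> (\<integral>x. iexp (s * ln x) \<partial>\<pi>)" for s
    by (intro conv) (auto intro!: continuous_intros)
  hence "(\<lambda>l. exp (of_real (d / 2) * ((\<integral>x. iexp (t * ln x) \<partial>m l) - 1)) *
    exp (of_real (d / 2) * ((\<integral>x. iexp (- t * ln x) \<partial>m l) - 1))) \<longlonglongrightarrow>
    exp (of_real (d / 2) * ((\<integral>x. iexp (t * ln x) \<partial>\<pi>) - 1)) *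
    exp (of_real (d / 2) * ((\<integral>x. iexp (- t * ln x) \<partial>\<pi>) - 1))"
    by (intro tendsto_intros)
  with 1 show ?thesis by (rule LIMSEQ_unique)
qed

section \<open>Weighted compound Poisson laws\<close>

lemma nn_integral_poisson_power:
  assumes d: "0 < d" and r: "0 \<le> r" "r \<le> 1"
  shows "(\<integral>\<^sup>+n. ennreal r ^ n \<partial>measure_pmf (poisson_pmf d)) = ennreal (exp (d * (r - 1)))"
proof -
  have i: "integrable (measure_pmf (poisson_pmf d)) (\<lambda>n. r ^ n)"
    using r by (intro measure_pmf.integrable_const_bound[where B=1]) (auto simp: power_le_one)
  have "complex_of_real (\<integral>n. r ^ n \<partial>measure_pmf (poisson_pmf d)) = (\<integral>n. complex_of_real r ^ n \<partial>measure_pmf (poisson_pmf d))"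
    by (subst integral_complex_of_real[symmetric]) simp
  also have "\<dots> = complex_of_real (exp (d * (r - 1)))"
    by (subst poisson_generating_function[OF d]) (simp add: exp_of_real[symmetric] del: exp_of_real)
  finally have "(\<integral>n. r ^ n \<partial>measure_pmf (poisson_pmf d)) = exp (d * (r - 1))" by (simp only: of_real_eq_iff)
  thus ?thesis using nn_integral_eq_integral[OF i] r by (simp add: ennreal_power)
qed

lemma poisson_mean:
  assumes d: "0 < d"
  shows "(\<integral>\<^sup>+n. of_nat n \<partial>measure_pmf (poisson_pmf d)) = ennreal d"
proof -
  have "(\<integral>\<^sup>+n. of_nat n \<partial>measure_pmf (poisson_pmf d)) = (\<Sum>n. ennreal (pmf (poisson_pmf d) n) * of_nat n)"
    by (simp add: nn_integral_measure_pmf nn_integral_count_space_nat)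
  also have "\<dots> = (\<Sum>n. ennreal (pmf (poisson_pmf d) (Suc n)) * of_nat (Suc n))"
    by (subst suminf_offset[of _ 1]) auto
  also have "\<dots> = (\<Sum>n. ennreal d * ennreal (pmf (poisson_pmf d) n))"
  proof (rule suminf_cong)
    fix n
    have "pmf (poisson_pmf d) (Suc n) * real (Suc n) = d * pmf (poisson_pmf d) n"
      using d by (simp add: field_simps del: of_nat_Suc)
    thus "ennreal (pmf (poisson_pmf d) (Suc n)) * of_nat (Suc n) = ennreal d * ennreal (pmf (poisson_pmf d) n)"
      using d by (simp only: ennreal_of_nat_eq_real_of_nat ennreal_mult[symmetric] pmf_nonneg of_nat_0_le_iff less_imp_le)
  qed
  also have "\<dots> = ennreal d * (\<Sum>n. ennreal (pmf (poisson_pmf d) n))"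
    by (rule ennreal_suminf_cmult)
  also have "(\<Sum>n. ennreal (pmf (poisson_pmf d) n)) = (\<integral>\<^sup>+n. 1 \<partial>measure_pmf (poisson_pmf d))"
    by (subst nn_integral_measure_pmf) (simp add: nn_integral_count_space_nat del: pmf_poisson)
  finally show ?thesis by simp
qed

lemma nn_integral_countable_support:
  assumes "sets M = sets (borel :: 'a :: t1_space measure)" and [measurable]: "g \<in> borel_measurable borel"
    and G: "countable G" and g: "\<And>x. x \<notin> G \<Longrightarrow> g x = 0"
  shows "(\<integral>\<^sup>+x. g x \<partial>M) = (\<integral>\<^sup>+x. g x * emeasure M {x} \<partial>count_space G)"
proof -
  note [measurable_cong] = assms(1)
  have [measurable]: "G \<in> sets borel" using G by (rule sets.countable[rotated]) simp
  have "(\<integral>\<^sup>+x. g x \<partial>M) = (\<integral>\<^sup>+x. g x * indicator G x \<partial>M)"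
    by (intro nn_integral_cong) (auto simp: indicator_def g)
  also have "\<dots> = emeasure (density M g) G" by (simp add: emeasure_density)
  also have "\<dots> = (\<integral>\<^sup>+x. emeasure (density M g) {x} \<partial>count_space G)"
    by (rule emeasure_countable_singleton) (use G in \<open>auto simp: assms(1)\<close>)
  also have "\<dots> = (\<integral>\<^sup>+x. g x * emeasure M {x} \<partial>count_space G)"
    by (intro nn_integral_cong) (simp add: emeasure_density assms(1))
  finally show ?thesis .
qed

text \<open>The expectation of \<open>f\<close> after one further jump from \<open>s\<close>, each jump \<open>y\<close> being weighted with
\<open>w y\<close>.\<close>

definition jump_step :: "real measure \<Rightarrow> (real \<Rightarrow> ennreal) \<Rightarrow> (real \<Rightarrow> ennreal) \<Rightarrow> real \<Rightarrow> ennreal" where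
  "jump_step \<nu> w f s = (\<integral>\<^sup>+y. w y * f (s + y) \<partial>\<nu>)"

lemma jump_step_funpow_Suc:
  "(jump_step \<nu> w ^^ Suc n) f s = (\<integral>\<^sup>+y. w y * (jump_step \<nu> w ^^ n) f (s + y) \<partial>\<nu>)"
  by (simp only: funpow.simps o_apply jump_step_def[of \<nu> w "(jump_step \<nu> w ^^ n) f"])

text \<open>The law of the sum of \<open>Po(d)\<close> many independent jumps. With the weight \<open>1\<close> this is the compound
Poisson law; a weight \<open>w \<le> 1\<close> restricts it to the event that every jump passes an
independent test, which jump \<open>y\<close> passes with probability \<open>w y\<close>.\<close>

definition cpoisson :: "real \<Rightarrow> real measure \<Rightarrow> (real \<Rightarrow> ennreal) \<Rightarrow> real measure" where
  "cpoisson d \<nu> w = distr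
     (density (measure_pmf (poisson_pmf d) \<Otimes>\<^sub>M (\<Pi>\<^sub>M i\<in>(UNIV :: nat set). \<nu>)) (\<lambda>(n, \<omega>). \<Prod>i<n. w (\<omega> i)))
     borel (\<lambda>(n, \<omega>). \<Sum>i<n. \<omega> i)"

context real_distribution
begin

lemma measurable_jump_step [measurable]:
  assumes [measurable]: "w \<in> borel_measurable borel" "f \<in> borel_measurable borel"
  shows "jump_step M w f \<in> borel_measurable borel"
  unfolding jump_step_def by measurable

lemma measurable_jump_step_funpow [measurable]:
  assumes [measurable]: "w \<in> borel_measurable borel" "f \<in> borel_measurable borel"
  shows "(jump_step M w ^^ n) f \<in> borel_measurable borel"
  by (induction n) auto

lemma jump_step_mono:
  "(\<And>y. w y \<le> w' y) \<Longrightarrow> (\<And>y. f y \<le> g y) \<Longrightarrow> jump_step M w f s \<le> jump_step M w' g s"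
  unfolding jump_step_def by (intro nn_integral_mono mult_mono) auto

lemma jump_step_funpow_mono:
  "(\<And>y. w y \<le> w' y) \<Longrightarrow> (\<And>y. f y \<le> g y) \<Longrightarrow> (jump_step M w ^^ n) f s \<le> (jump_step M w' ^^ n) g s"
  by (induction n arbitrary: s) (auto intro!: jump_step_mono)

lemma jump_step_const: 
  assumes [measurable]: "w \<in> borel_measurable borel" 
  shows "jump_step M w (\<lambda>_. c) = (\<lambda>_. (\<integral>\<^sup>+y. w y \<partial>M) * c)"
  unfolding jump_step_def by (simp add: nn_integral_multc)

lemma jump_step_funpow_const: 
  assumes [measurable]: "w \<in> borel_measurable borel" 
  shows "(jump_step M w ^^ n) (\<lambda>_. c) = (\<lambda>_. (\<integral>\<^sup>+y. w y \<partial>M) ^ n * c)"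
  by (induction n) (auto simp: jump_step_const ac_simps)

lemma jump_step_commute:
  assumes [measurable]: "w \<in> borel_measurable borel" "v \<in> borel_measurable borel" "f \<in> borel_measurable borel"
  shows "jump_step M w (jump_step M v f) = jump_step M v (jump_step M w f)"
proof
  fix s
  interpret P: pair_sigma_finite M M ..
  have "jump_step M w (jump_step M v f) s = (\<integral>\<^sup>+y. \<integral>\<^sup>+z. w y * v z * f (s + y + z) \<partial>M \<partial>M)"
    unfolding jump_step_def by (simp add: nn_integral_cmult[symmetric] mult.assoc)
  also have "\<dots> = (\<integral>\<^sup>+z. \<integral>\<^sup>+y. w y * v z * f (s + y + z) \<partial>M \<partial>M)"
    by (rule P.Fubini'[symmetric]) measurable
  also have "\<dots> = jump_step M v (jump_step M w f) s"
    unfolding jump_step_def by (simp add: nn_integral_cmult[symmetric] ac_simps)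
  finally show "jump_step M w (jump_step M v f) s = jump_step M v (jump_step M w f) s" .
qed

lemma jump_step_funpow_commute:
  assumes [measurable]: "w \<in> borel_measurable borel" "v \<in> borel_measurable borel" "f \<in> borel_measurable borel"
  shows "jump_step M w ((jump_step M v ^^ n) f) = (jump_step M v ^^ n) (jump_step M w f)"
  by (induction n) (simp_all add: jump_step_commute)

text \<open>Union bound: the difference of the two sides is the probability of ending in the target with some
jump failing its test. Telescoping over the jumps leaves \<open>n\<close> terms with one distinguished failing
jump. As the operators commute, that jump can be made the last one, where the hypothesis on \<open>C\<close>
applies whatever the sum of the other jumps is.\<close>

lemma jump_step_thinning_bound:
  assumes [measurable]: "w \<in> borel_measurable borel" "h \<in> borel_measurable borel" "f \<in> borel_measurable borel"
    and wh: "\<And>y. w y + h y = 1" and C: "\<And>s. jump_step M h f s \<le> C"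
  shows "(jump_step M (\<lambda>_. 1) ^^ n) f s \<le> (jump_step M w ^^ n) f s + of_nat n * C"
proof (induction n arbitrary: s)
  case (Suc n)
  let ?U = "jump_step M (\<lambda>_. 1)"
  have w1: "w y \<le> 1" for y using wh[of y] by (metis le_iff_add)
  have Uw: "jump_step M w (\<lambda>_. of_nat n * C) s \<le> of_nat n * C"
  proof -
    have "(\<integral>\<^sup>+y. w y \<partial>M) \<le> (\<integral>\<^sup>+y. 1 \<partial>M)" by (intro nn_integral_mono w1)
    also have "\<dots> = 1" using emeasure_space_1 by simp
    finally show ?thesis using mult_right_mono by (simp add: jump_step_const) fastforce
  qed
  have Uh: "jump_step M h ((?U ^^ n) f) s \<le> C"
  proof -
    have "jump_step M h ((?U ^^ n) f) s = (?U ^^ n) (jump_step M h f) s"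
      by (subst jump_step_funpow_commute) auto
    also have "\<dots> \<le> (?U ^^ n) (\<lambda>_. C) s" by (rule jump_step_funpow_mono) (use C in auto)
    also have "\<dots> = C" using emeasure_space_1 by (simp add: jump_step_funpow_const)
    finally show ?thesis .
  qed
  have "(?U ^^ Suc n) f s = (\<integral>\<^sup>+y. (w y + h y) * (?U ^^ n) f (s + y) \<partial>M)"
    by (simp add: jump_step_def wh)
  also have "\<dots> = jump_step M w ((?U ^^ n) f) s + jump_step M h ((?U ^^ n) f) s"
    by (simp add: jump_step_def distrib_right nn_integral_add)
  also have "jump_step M w ((?U ^^ n) f) s \<le> jump_step M w (\<lambda>s. (jump_step M w ^^ n) f s + of_nat n * C) s"
    by (rule jump_step_mono) (use Suc in auto)
  also have "\<dots> = (jump_step M w ^^ Suc n) f s + jump_step M w (\<lambda>_. of_nat n * C) s"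
    by (simp add: jump_step_def distrib_left nn_integral_add)
  also note Uw
  also note Uh
  finally show ?case by (simp add: ac_simps add_mono algebra_simps)
qed simp

lemma nn_integral_sum_jumps:
  assumes [measurable]: "w \<in> borel_measurable borel" "f \<in> borel_measurable borel"
  shows "(\<integral>\<^sup>+\<omega>. (\<Prod>i<n. w (\<omega> i)) * f (s + (\<Sum>i<n. \<omega> i)) \<partial>(\<Pi>\<^sub>M i\<in>(UNIV::nat set). M)) = (jump_step M w ^^ n) f s"
proof (induction n arbitrary: s)
  interpret SS: sequence_space M ..
  {
    case 0
    show ?case using SS.P.emeasure_space_1 by simp
  next
    case (Suc n)
    interpret P: pair_sigma_finite M SS.S ..
    let ?F = "\<lambda>\<omega>. (\<Prod>i<Suc n. w (\<omega> i)) * f (s + (\<Sum>i<Suc n. \<omega> i))"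
    have "(\<integral>\<^sup>+\<omega>. ?F \<omega> \<partial>SS.S) = (\<integral>\<^sup>+\<omega>. ?F \<omega> \<partial>(distr (M \<Otimes>\<^sub>M SS.S) SS.S (\<lambda>(s, \<omega>). case_nat s \<omega>)))"
      by (simp only: SS.PiM_iter)
    also have "\<dots> = (\<integral>\<^sup>+(y, \<omega>). ?F (case_nat y \<omega>) \<partial>(M \<Otimes>\<^sub>M SS.S))"
      by (subst nn_integral_distr) (auto simp: case_prod_unfold)
    also have "\<dots> = (\<integral>\<^sup>+y. \<integral>\<^sup>+\<omega>. ?F (case_nat y \<omega>) \<partial>SS.S \<partial>M)"
      using SS.P.nn_integral_fst[of "\<lambda>(y, \<omega>). ?F (case_nat y \<omega>)" M] by (simp only: prod.case) simp
    also have "\<dots> = (\<integral>\<^sup>+y. w y * (\<integral>\<^sup>+\<omega>. (\<Prod>i<n. w (\<omega> i)) * f ((s + y) + (\<Sum>i<n. \<omega> i)) \<partial>SS.S) \<partial>M)"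
      by (subst nn_integral_cmult[symmetric]) (auto simp: lessThan_Suc_eq_insert_0 prod.reindex sum.reindex ac_simps intro!: nn_integral_cong)
    also have "\<dots> = (jump_step M w ^^ Suc n) f s"
      by (simp only: Suc jump_step_funpow_Suc)
    finally show ?case .
  }
qed

lemma measurable_cpoisson_aux:
  assumes "\<And>n. (\<lambda>\<omega>. F (n, \<omega>)) \<in> measurable (\<Pi>\<^sub>M i\<in>(UNIV :: nat set). M) N"
  shows "F \<in> measurable (measure_pmf (poisson_pmf d) \<Otimes>\<^sub>M (\<Pi>\<^sub>M i\<in>(UNIV :: nat set). M)) N"
proof -
  have "F \<in> measurable (count_space UNIV \<Otimes>\<^sub>M (\<Pi>\<^sub>M i\<in>(UNIV :: nat set). M)) N"
    by (rule measurable_pair_measure_countable1) (use assms in auto)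
  moreover have "sets (measure_pmf (poisson_pmf d) \<Otimes>\<^sub>M (\<Pi>\<^sub>M i\<in>(UNIV :: nat set). M)) =
      sets (count_space UNIV \<Otimes>\<^sub>M (\<Pi>\<^sub>M i\<in>(UNIV :: nat set). M))"
    by (intro sets_pair_measure_cong sets_measure_pmf_count_space refl)
  ultimately show ?thesis using measurable_cong_sets by blast
qed

lemma sets_cpoisson [simp, measurable_cong]: "sets (cpoisson d M w) = sets borel"
  by (simp add: cpoisson_def)

lemma nn_integral_cpoisson:
  assumes [measurable]: "w \<in> borel_measurable borel" "f \<in> borel_measurable borel"
  shows "(\<integral>\<^sup>+x. f x \<partial>cpoisson d M w) = (\<integral>\<^sup>+n. (jump_step M w ^^ n) f 0 \<partial>measure_pmf (poisson_pmf d))"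
proof -
  interpret SS: sequence_space M ..
  let ?Q = "measure_pmf (poisson_pmf d) \<Otimes>\<^sub>M SS.S"
  have [measurable]: "(\<lambda>(n, \<omega>). \<Prod>i<n. w (\<omega> i)) \<in> borel_measurable ?Q"
    "(\<lambda>(n, \<omega>). \<Sum>i<n. \<omega> i) \<in> borel_measurable ?Q"
    by (rule measurable_cpoisson_aux; simp)+
  have "(\<integral>\<^sup>+x. f x \<partial>cpoisson d M w) = (\<integral>\<^sup>+(n, \<omega>). (\<Prod>i<n. w (\<omega> i)) * f (\<Sum>i<n. \<omega> i) \<partial>?Q)"
    unfolding cpoisson_def
    by (subst nn_integral_distr) (auto simp: nn_integral_density case_prod_unfold)
  also have "\<dots> = (\<integral>\<^sup>+n. \<integral>\<^sup>+\<omega>. (\<Prod>i<n. w (\<omega> i)) * f (\<Sum>i<n. \<omega> i) \<partial>SS.S \<partial>measure_pmf (poisson_pmf d))"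
    by (subst SS.P.nn_integral_fst[symmetric]) (auto intro!: measurable_cpoisson_aux)
  also have "\<dots> = (\<integral>\<^sup>+n. (jump_step M w ^^ n) f 0 \<partial>measure_pmf (poisson_pmf d))"
    using nn_integral_sum_jumps[of w f _ 0] by simp
  finally show ?thesis .
qed

lemma emeasure_cpoisson:
  assumes [measurable]: "w \<in> borel_measurable borel" "A \<in> sets borel"
  shows "emeasure (cpoisson d M w) A = (\<integral>\<^sup>+n. (jump_step M w ^^ n) (indicator A) 0 \<partial>measure_pmf (poisson_pmf d))"
  using nn_integral_cpoisson[of w "indicator A" d] by simp

lemma emeasure_cpoisson_mono:
  assumes [measurable]: "w \<in> borel_measurable borel" "w' \<in> borel_measurable borel" and A [measurable]: "A \<in> sets borel" 
    and w: "\<And>y. w y \<le> w' y"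
  shows "emeasure (cpoisson d M w) A \<le> emeasure (cpoisson d M w') A"
  by (auto simp: emeasure_cpoisson intro!: nn_integral_mono jump_step_funpow_mono w)

lemma emeasure_cpoisson_UNIV:
  assumes d: "0 < d" and [measurable]: "w \<in> borel_measurable borel" and r: "(\<integral>\<^sup>+y. w y \<partial>M) = ennreal r" "0 \<le> r" "r \<le> 1"
  shows "emeasure (cpoisson d M w) UNIV = ennreal (exp (d * (r - 1)))"
  using r by (simp add: emeasure_cpoisson nn_integral_poisson_power d jump_step_funpow_const)

text \<open>The factor \<open>d\<close> is the mean number of jumps.\<close>

lemma emeasure_cpoisson_thinning_bound:
  assumes d: "0 < d" and [measurable]: "w \<in> borel_measurable borel" "h \<in> borel_measurable borel" and A [measurable]: "A \<in> sets borel"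
    and wh: "\<And>y. w y + h y = 1" and C: "\<And>s. jump_step M h (indicator A) s \<le> C"
  shows "emeasure (cpoisson d M (\<lambda>_. 1)) A \<le> emeasure (cpoisson d M w) A + ennreal d * C"
proof -
  have "emeasure (cpoisson d M (\<lambda>_. 1)) A \<le>
      (\<integral>\<^sup>+n. (jump_step M w ^^ n) (indicator A) 0 + of_nat n * C \<partial>measure_pmf (poisson_pmf d))"
    by (subst emeasure_cpoisson) (auto intro!: nn_integral_mono jump_step_thinning_bound wh C)
  also have "\<dots> = emeasure (cpoisson d M w) A + ennreal d * C"
    by (simp add: nn_integral_add nn_integral_multc poisson_mean d emeasure_cpoisson)
  finally show ?thesis .
qed

lemma emeasure_cpoisson_ge_term:
  assumes [measurable]: "w \<in> borel_measurable borel" "A \<in> sets borel"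
  shows "ennreal (pmf (poisson_pmf d) n) * (jump_step M w ^^ n) (indicator A) 0 \<le> emeasure (cpoisson d M w) A"
proof -
  have "ennreal (pmf (poisson_pmf d) n) * (jump_step M w ^^ n) (indicator A) 0 =
     (\<integral>\<^sup>+k. (jump_step M w ^^ n) (indicator A) 0 * indicator {n} k \<partial>measure_pmf (poisson_pmf d))"
    by (subst nn_integral_cmult_indicator) (simp_all add: emeasure_pmf_single mult.commute)
  also have "\<dots> \<le> (\<integral>\<^sup>+n. (jump_step M w ^^ n) (indicator A) 0 \<partial>measure_pmf (poisson_pmf d))"
    by (intro nn_integral_mono) (auto simp: indicator_def)
  finally show ?thesis by (simp add: emeasure_cpoisson)
qed

lemma real_distribution_cpoisson:
  assumes d: "0 < d"
  shows "real_distribution (cpoisson d M (\<lambda>_. 1))"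
proof -
  have "emeasure (cpoisson d M (\<lambda>_. 1)) UNIV = ennreal (exp (d * (1 - 1)))"
    by (rule emeasure_cpoisson_UNIV) (use d emeasure_space_1 in auto)
  thus ?thesis
    by (auto simp: real_distribution_def real_distribution_axioms_def cpoisson_def intro!: prob_spaceI)
qed

lemma char_cpoisson:
  assumes d: "0 < d"
  shows "char (cpoisson d M (\<lambda>_. 1)) t = exp (of_real d * (char M t - 1))"
proof -
  interpret SS: sequence_space M ..
  let ?P = "measure_pmf (poisson_pmf d)"
  interpret PS: pair_prob_space ?P SS.S ..
  have [measurable]: "(\<lambda>(n, \<omega>). \<Sum>i<n. \<omega> i) \<in> borel_measurable (?P \<Otimes>\<^sub>M SS.S)"
    by (rule measurable_cpoisson_aux; simp)+
  have int: "integrable (?P \<Otimes>\<^sub>M SS.S) (\<lambda>(n, \<omega>). iexp (t * (\<Sum>i<n. \<omega> i)))"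
    by (rule PS.integrable_const_bound[where B=1]) (auto simp: intro!: measurable_cpoisson_aux)
  have "char (cpoisson d M (\<lambda>_. 1)) t = (\<integral>(n, \<omega>). iexp (t * (\<Sum>i<n. \<omega> i)) \<partial>(?P \<Otimes>\<^sub>M SS.S))"
    unfolding char_def cpoisson_def
    by (subst integral_distr) (auto simp: case_prod_unfold density_1)
  also have "\<dots> = (\<integral>n. \<integral>\<omega>. iexp (t * (\<Sum>i<n. \<omega> i)) \<partial>SS.S \<partial>?P)"
    using PS.integral_fst'[OF int] by simp
  also have "\<dots> = (\<integral>n. char M t ^ n \<partial>?P)"
  proof (intro Bochner_Integration.integral_cong refl)
    fix n :: nat
    have "(\<integral>\<omega>. iexp (t * (\<Sum>i<n. \<omega> i)) \<partial>SS.S) = (\<integral>\<omega>. (\<Prod>i<n. iexp (t * \<omega> i)) \<partial>SS.S)"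
      by (simp add: sum_distrib_left exp_sum)
    also have "\<dots> = (\<Prod>i<n. char M t)"
      unfolding char_def
      by (rule integral_PiM_prod) (auto intro!: integrable_const_bound[where B=1] prob_space_axioms)
    finally show "(\<integral>\<omega>. iexp (t * (\<Sum>i<n. \<omega> i)) \<partial>SS.S) = char M t ^ n" by simp
  qed
  also have "\<dots> = exp (of_real d * (char M t - 1))"
    by (rule poisson_generating_function[OF d])
  finally show ?thesis .
qed

end

section \<open>The fixed point equation for the log-odds\<close>

lemma ennreal_half_mult_pos: "0 < a \<Longrightarrow> 0 < ennreal (1 / 2) * a"
  unfolding ennreal_zero_less_mult_iff ennreal_less_zero_iff by simp

lemma ennreal_half_plus_half: "ennreal (1 / 2) * a + ennreal (1 / 2) * a = a"
proof -
  have "ennreal (1 / 2) + ennreal (1 / 2) = 1" by (subst ennreal_plus[symmetric]) auto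
  thus ?thesis by (simp only: distrib_right[symmetric] mult_1)
qed

text \<open>The negative logarithm of the probability whose log-odds are \<open>x\<close>.\<close>

definition surprisal :: "real \<Rightarrow> real" where "surprisal x = ln (1 + exp (- x))"

definition inv_surprisal :: "real \<Rightarrow> real" where "inv_surprisal y = - ln (exp y - 1)"

lemma measurable_surprisal [measurable]: "surprisal \<in> borel_measurable borel"
  and measurable_inv_surprisal [measurable]: "inv_surprisal \<in> borel_measurable borel"
  unfolding surprisal_def inv_surprisal_def by measurable

lemma exp_surprisal: "exp (surprisal x) = 1 + exp (- x)"
  by (simp add: surprisal_def add_pos_pos)

lemma surprisal_pos: "0 < surprisal x"
  by (simp add: surprisal_def ln_gt_zero)

lemma inv_surprisal_surprisal [simp]: "inv_surprisal (surprisal x) = x"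
  by (simp add: inv_surprisal_def exp_surprisal)

lemma surprisal_inv_surprisal: "0 < y \<Longrightarrow> surprisal (inv_surprisal y) = y"
  by (simp add: surprisal_def inv_surprisal_def)

lemma surprisal_logit: "0 < x \<Longrightarrow> x < 1 \<Longrightarrow> surprisal (logit x) = - ln x"
proof -
  assume x: "0 < x" "x < 1"
  have "1 + exp (- logit x) = 1 / x"
    using x by (simp add: logit_def exp_minus field_simps)
  thus ?thesis using x by (simp add: surprisal_def ln_div)
qed

text \<open>The log-odds of the rational numbers in \<open>(0,1)\<close>: a countable dense subgroup of the line.\<close>

definition log_rats :: "real set" where "log_rats = {x. exp x \<in> \<rat>}"

lemma countable_log_rats: "countable log_rats"
proof (rule countable_image_inj_on)
  show "countable (exp ` log_rats)" using countable_rat by (rule countable_subset[rotated]) (auto simp: log_rats_def)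
qed (auto simp: inj_on_def)

lemma sets_log_rats [measurable]: "log_rats \<in> sets borel"
  using countable_log_rats by (rule sets.countable[rotated]) simp

lemma zero_in_log_rats [simp]: "0 \<in> log_rats" by (simp add: log_rats_def)

lemma uminus_log_rats [simp]: "- x \<in> log_rats \<longleftrightarrow> x \<in> log_rats"
  using Rats_inverse[of "exp x"] Rats_inverse[of "exp (- x)"] by (auto simp: log_rats_def exp_minus)

lemma add_log_rats: "x \<in> log_rats \<Longrightarrow> y \<in> log_rats \<Longrightarrow> x + y \<in> log_rats"
  by (simp add: log_rats_def exp_add)

lemma add_log_rats_iff: "x \<in> log_rats \<Longrightarrow> x + y \<in> log_rats \<longleftrightarrow> y \<in> log_rats"
  using add_log_rats[of x y] add_log_rats[of "- x" "x + y"] by auto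

lemma surprisal_log_rats [simp]: "surprisal x \<in> log_rats \<longleftrightarrow> x \<in> log_rats"
proof -
  have "surprisal x \<in> log_rats \<longleftrightarrow> 1 + exp (- x) \<in> \<rat>" by (simp add: log_rats_def exp_surprisal)
  also have "\<dots> \<longleftrightarrow> exp (- x) \<in> \<rat>" using Rats_diff[of "1 + exp (- x)" 1] by auto
  finally show ?thesis using uminus_log_rats[of x] by (simp add: log_rats_def)
qed

lemma log_rats_dense:
  assumes "u < v"
  shows "\<exists>y\<in>log_rats. u < y \<and> y < v \<and> y \<noteq> 0"
proof -
  \<comment> \<open>Raising the left end to \<open>0\<close> whenever the interval meets the positive half-line avoids \<open>y = 0\<close>.\<close>
  define u' where "u' = (if 0 < v then max u 0 else u)"
  have "exp u' < exp v" using assms by (auto simp: u'_def)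
  then obtain q where q: "q \<in> \<rat>" "exp u' < q" "q < exp v" using Rats_dense_in_real by blast
  have q0: "0 < q" using q(2) by (meson exp_gt_zero less_trans)
  have "u' < ln q" "ln q < v" using q q0 exp_less_cancel_iff[of u' "ln q"] exp_less_cancel_iff[of "ln q" v] by simp_all
  moreover have "ln q \<in> log_rats" using q q0 by (simp add: log_rats_def)
  ultimately show ?thesis by (intro bexI[of _ "ln q"]) (auto simp: u'_def split: if_splits)
qed

text \<open>The law of one jump: a clause pushes the log-odds up or down with equal probability, by the surprisal
of its other literal.\<close>

definition jump_law :: "real measure \<Rightarrow> real measure" where
  "jump_law \<rho> = distr (measure_pmf (bernoulli_pmf (1 / 2)) \<Otimes>\<^sub>M \<rho>) borel
     (\<lambda>(b, x). if b then surprisal x else - surprisal x)"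

context real_distribution
begin

lemma measurable_jump [measurable]:
  "(\<lambda>(b, x). if b then surprisal x else - surprisal x) \<in> borel_measurable (measure_pmf (bernoulli_pmf (1 / 2)) \<Otimes>\<^sub>M M)"
proof -
  have "(\<lambda>(b, x). if b then surprisal x else - surprisal x) \<in> borel_measurable (count_space UNIV \<Otimes>\<^sub>M M)"
    by (rule measurable_pair_measure_countable1) auto
  moreover have "sets (measure_pmf (bernoulli_pmf (1 / 2)) \<Otimes>\<^sub>M M) = sets (count_space UNIV \<Otimes>\<^sub>M M)"
    by (intro sets_pair_measure_cong sets_measure_pmf_count_space refl)
  ultimately show ?thesis using measurable_cong_sets by blast
qed

lemma real_distribution_jump_law: "real_distribution (jump_law M)"
proof -
  interpret pair_prob_space "measure_pmf (bernoulli_pmf (1 / 2))" M ..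
  show ?thesis
    by (auto simp: real_distribution_def real_distribution_axioms_def jump_law_def intro!: prob_space_distr)
qed

lemma nn_integral_jump_law:
  assumes [measurable]: "f \<in> borel_measurable borel"
  shows "(\<integral>\<^sup>+y. f y \<partial>jump_law M) =
    ennreal (1 / 2) * (\<integral>\<^sup>+x. f (surprisal x) \<partial>M) + ennreal (1 / 2) * (\<integral>\<^sup>+x. f (- surprisal x) \<partial>M)"
proof -
  let ?P = "measure_pmf (bernoulli_pmf (1 / 2))"
  let ?f = "\<lambda>p :: bool \<times> real. f (case p of (b, x) \<Rightarrow> if b then surprisal x else - surprisal x)"
  have "(\<integral>\<^sup>+y. f y \<partial>jump_law M) = (\<integral>\<^sup>+p. ?f p \<partial>(?P \<Otimes>\<^sub>M M))"
    unfolding jump_law_def by (rule nn_integral_distr) auto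
  also have "\<dots> = (\<integral>\<^sup>+b. \<integral>\<^sup>+x. ?f (b, x) \<partial>M \<partial>?P)"
    by (rule nn_integral_fst[symmetric]) measurable
  also have "\<dots> = ennreal (1 / 2) * (\<integral>\<^sup>+x. f (surprisal x) \<partial>M) + ennreal (1 / 2) * (\<integral>\<^sup>+x. f (- surprisal x) \<partial>M)"
    by (simp add: nn_integral_measure_pmf nn_integral_count_space_finite UNIV_bool ac_simps)
  finally show ?thesis .
qed

lemma char_jump_law:
  "char (jump_law M) t = (\<integral>x. iexp (t * surprisal x) \<partial>M) / 2 + (\<integral>x. iexp (- t * surprisal x) \<partial>M) / 2"
proof -
  let ?P = "measure_pmf (bernoulli_pmf (1 / 2))"
  let ?f = "\<lambda>p :: bool \<times> real. iexp (t * (case p of (b, x) \<Rightarrow> if b then surprisal x else - surprisal x))"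
  interpret P: pair_prob_space ?P M ..
  have int: "integrable (?P \<Otimes>\<^sub>M M) ?f"
    by (rule P.integrable_const_bound[where B=1]) auto
  have "char (jump_law M) t = (\<integral>p. ?f p \<partial>(?P \<Otimes>\<^sub>M M))"
    unfolding jump_law_def char_def by (rule integral_distr) auto
  also have "\<dots> = (\<integral>b. \<integral>x. ?f (b, x) \<partial>M \<partial>?P)"
    by (rule P.integral_fst'[OF int, symmetric])
  also have "\<dots> = (\<integral>x. iexp (t * surprisal x) \<partial>M) / 2 + (\<integral>x. iexp (- t * surprisal x) \<partial>M) / 2"
    by (subst integral_measure_pmf[of UNIV]) (auto simp: UNIV_bool scaleR_conv_of_real)
  finally show ?thesis .
qed

lemma emeasure_jump_law_invariant:
  assumes [measurable]: "A \<in> sets borel"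
    and A: "\<And>x. surprisal x \<in> A \<longleftrightarrow> x \<in> A" "\<And>x. - surprisal x \<in> A \<longleftrightarrow> x \<in> A"
  shows "emeasure (jump_law M) A = emeasure M A"
proof -
  have ind: "(indicator A (surprisal x) :: ennreal) = indicator A x" "(indicator A (- surprisal x) :: ennreal) = indicator A x" for x
    by (simp_all only: indicator_def A)
  interpret J: real_distribution "jump_law M" by (rule real_distribution_jump_law)
  have "emeasure (jump_law M) A = (\<integral>\<^sup>+y. indicator A y \<partial>jump_law M)" by simp
  also have "\<dots> = (\<integral>\<^sup>+x. indicator A x \<partial>M)"
    by (subst nn_integral_jump_law) (simp_all only: ind ennreal_half_plus_half, measurable)
  finally show ?thesis by simp
qed

lemma jump_law_singleton:
  "ennreal (1 / 2) * emeasure M {u} \<le> emeasure (jump_law M) {surprisal u}"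
  "ennreal (1 / 2) * emeasure M {u} \<le> emeasure (jump_law M) {- surprisal u}"
proof -
  interpret J: real_distribution "jump_law M" by (rule real_distribution_jump_law)
  have J: "emeasure (jump_law M) {y} = ennreal (1 / 2) * (\<integral>\<^sup>+x. indicator {y} (surprisal x) \<partial>M) +
     ennreal (1 / 2) * (\<integral>\<^sup>+x. indicator {y} (- surprisal x) \<partial>M)" for y
    using nn_integral_jump_law[of "indicator {y}"] by simp
  have E: "emeasure M {u} = (\<integral>\<^sup>+x. indicator {u} x \<partial>M)" by simp
  have "ennreal (1 / 2) * emeasure M {u} \<le> ennreal (1 / 2) * (\<integral>\<^sup>+x. indicator {surprisal u} (surprisal x) \<partial>M)"
    unfolding E by (intro mult_left_mono nn_integral_mono) (auto simp: indicator_def)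
  also have "\<dots> \<le> emeasure (jump_law M) {surprisal u}" unfolding J by simp
  finally show "ennreal (1 / 2) * emeasure M {u} \<le> emeasure (jump_law M) {surprisal u}" .
  have "ennreal (1 / 2) * emeasure M {u} \<le> ennreal (1 / 2) * (\<integral>\<^sup>+x. indicator {- surprisal u} (- surprisal x) \<partial>M)"
    unfolding E by (intro mult_left_mono nn_integral_mono) (auto simp: indicator_def)
  also have "\<dots> \<le> emeasure (jump_law M) {- surprisal u}" unfolding J by simp
  finally show "ennreal (1 / 2) * emeasure M {u} \<le> emeasure (jump_law M) {- surprisal u}" .
qed

end

text \<open>Two independent \<open>Po(d/2)\<close> families of upward and of downward jumps are the same as \<open>Po(d)\<close> many
jumps with fair signs; on the level of characteristic functions this is the identity
\<open>exp (d/2 (u - 1)) exp (d/2 (v - 1)) = exp (d ((u + v) / 2 - 1))\<close>.\<close>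

lemma log_odds_law_fixed_point:
  assumes d: "0 < d" "d < 2" and u: "unit_law \<pi>" and lim: "BP_limit d \<pi>"
  defines "\<rho> \<equiv> distr \<pi> borel logit"
  shows "real_distribution \<rho>" and "\<rho> = cpoisson d (jump_law \<rho>) (\<lambda>_. 1)"
proof -
  interpret \<pi>: real_distribution \<pi> using u by (simp add: unit_law_def)
  show rd: "real_distribution \<rho>" unfolding \<rho>_def
    by (auto simp: real_distribution_def real_distribution_axioms_def intro!: \<pi>.prob_space_distr)
  then interpret \<rho>: real_distribution \<rho> .
  interpret J: real_distribution "jump_law \<rho>" by (rule \<rho>.real_distribution_jump_law)
  have s: "(\<integral>x. iexp (t * surprisal x) \<partial>\<rho>) = (\<integral>x. iexp (- t * ln x) \<partial>\<pi>)" for t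
  proof -
    have "(\<integral>x. iexp (t * surprisal x) \<partial>\<rho>) = (\<integral>x. iexp (t * surprisal (logit x)) \<partial>\<pi>)"
      unfolding \<rho>_def by (rule integral_distr) auto
    also have "\<dots> = (\<integral>x. iexp (- t * ln x) \<partial>\<pi>)"
    proof (rule integral_cong_AE)
      have "AE x in \<pi>. 0 < x \<and> x < 1" using u by (simp add: unit_law_def)
      thus "AE x in \<pi>. iexp (t * surprisal (logit x)) = iexp (- t * ln x)"
        by eventually_elim (simp add: surprisal_logit)
    qed measurable
    finally show ?thesis .
  qed
  have "char \<rho> t = char (cpoisson d (jump_law \<rho>) (\<lambda>_. 1)) t" for t
  proof -
    have "char \<rho> t = (\<integral>x. iexp (t * logit x) \<partial>\<pi>)"
      unfolding char_def \<rho>_def by (rule integral_distr) auto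
    also have "\<dots> = exp (of_real d * (char (jump_law \<rho>) t - 1))"
      unfolding char_logit_BP_limit[OF d u lim] \<rho>.char_jump_law s exp_add[symmetric]
      by (rule arg_cong[where f=exp]) (simp add: field_simps)
    finally show ?thesis by (simp add: J.char_cpoisson d)
  qed
  thus "\<rho> = cpoisson d (jump_law \<rho>) (\<lambda>_. 1)"
    by (intro Levy_uniqueness rd J.real_distribution_cpoisson d) auto
qed

section \<open>Atoms and diffuse part of the log-odds\<close>

locale log_odds_fixed_point = real_distribution \<rho> for \<rho> :: "real measure" +
  fixes d :: real
  assumes d_pos: "0 < d" and fixed_point: "\<rho> = cpoisson d (jump_law \<rho>) (\<lambda>_. 1)"
begin

sublocale J: real_distribution "jump_law \<rho>"
  by (rule real_distribution_jump_law)

lemma fixed_point_ge_term: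
  assumes "A \<in> sets borel"
  shows "ennreal (pmf (poisson_pmf d) n) * (jump_step (jump_law \<rho>) (\<lambda>_. 1) ^^ n) (indicator A) 0 \<le> emeasure \<rho> A"
  using J.emeasure_cpoisson_ge_term[of "\<lambda>_. 1" A d n] assms fixed_point by simp

lemma poisson_pmf_pos: "0 < ennreal (pmf (poisson_pmf d) n)"
  using d_pos by simp

lemma surprisal_atom:
  assumes "0 < emeasure \<rho> {u}"
  shows "0 < emeasure \<rho> {surprisal u}" "0 < emeasure \<rho> {- surprisal u}"
proof -
  have gt: "0 < emeasure \<rho> {y}" if "0 < emeasure (jump_law \<rho>) {y}" for y
  proof -
    have "(jump_step (jump_law \<rho>) (\<lambda>_. 1) ^^ 1) (indicator {y}) 0 = emeasure (jump_law \<rho>) {y}"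
      by (simp add: jump_step_def)
    hence "0 < ennreal (pmf (poisson_pmf d) 1) * (jump_step (jump_law \<rho>) (\<lambda>_. 1) ^^ 1) (indicator {y}) 0"
      using poisson_pmf_pos[of 1] that by (simp only: ennreal_zero_less_mult_iff)
    also have "\<dots> \<le> emeasure \<rho> {y}" by (rule fixed_point_ge_term) simp
    finally show ?thesis .
  qed
  have "0 < ennreal (1 / 2) * emeasure \<rho> {u}" using assms by (rule ennreal_half_mult_pos)
  thus "0 < emeasure \<rho> {surprisal u}" "0 < emeasure \<rho> {- surprisal u}"
    using jump_law_singleton[of u] by (auto intro!: gt elim: less_le_trans)
qed

text \<open>The Euclidean algorithm: a downward jump turns the odds \<open>a / (b - a)\<close> into \<open>a / b\<close> if \<open>a < b\<close>,
and an upward jump turns \<open>b / (a - b)\<close> into \<open>a / b\<close> if \<open>b < a\<close>.\<close>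

lemma log_ratio_atom:
  assumes "0 < a" "0 < b"
  shows "0 < emeasure \<rho> {ln (real a / real b)}"
  using assms
proof (induction "a + b" arbitrary: a b rule: less_induct)
  case less
  consider "a = b" | "a < b" | "b < a" by linarith
  thus ?case
  proof cases
    case 1
    have "0 < ennreal (pmf (poisson_pmf d) 0) * (jump_step (jump_law \<rho>) (\<lambda>_. 1) ^^ 0) (indicator {0}) 0"
      using poisson_pmf_pos[of 0] by (simp add: ennreal_zero_less_mult_iff del: pmf_poisson)
    also have "\<dots> \<le> emeasure \<rho> {0}" by (rule fixed_point_ge_term) simp
    finally show ?thesis using 1 less.prems by simp
  next
    case 2
    define u where "u = ln (real a / real (b - a))"
    have u: "0 < emeasure \<rho> {u}" unfolding u_def using 2 less.prems by (intro less.hyps) auto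
    have "1 + exp (- u) = real b / real a"
      using 2 less.prems by (simp add: u_def exp_minus of_nat_diff field_simps)
    hence "- surprisal u = ln (real a / real b)"
      using less.prems by (simp add: surprisal_def ln_div)
    thus ?thesis using surprisal_atom(2)[OF u] by simp
  next
    case 3
    define u where "u = ln (real b / real (a - b))"
    have u: "0 < emeasure \<rho> {u}" unfolding u_def using 3 less.prems by (intro less.hyps) auto
    have "1 + exp (- u) = real a / real b"
      using 3 less.prems by (simp add: u_def exp_minus of_nat_diff field_simps)
    hence "surprisal u = ln (real a / real b)"
      by (simp add: surprisal_def)
    thus ?thesis using surprisal_atom(1)[OF u] by simp
  qed
qed

lemma log_rats_atom:
  assumes "x \<in> log_rats"
  shows "0 < emeasure \<rho> {x}"
proof -
  have "exp x \<in> \<rat>" using assms by (simp add: log_rats_def)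
  then obtain m n :: nat where mn: "n \<noteq> 0" "\<bar>exp x\<bar> = real m / real n"
    by (rule Rats_abs_nat_div_natE)
  have "exp x = real m / real n" using mn(2) by simp
  moreover from this have "0 < m" using mn(1) by (cases "m = 0") auto
  ultimately show ?thesis using log_ratio_atom[of m n] mn(1) by (metis ln_exp gr0I)
qed

text \<open>Weights that vanish off the group confine the sum to the group.\<close>

lemma jump_step_supported:
  assumes w: "\<And>y. y \<notin> log_rats \<Longrightarrow> w y = 0" and s: "s \<in> log_rats"
  shows "(jump_step (jump_law \<rho>) w ^^ n) (indicator A) s = (jump_step (jump_law \<rho>) w ^^ n) (indicator (A \<inter> log_rats)) s"
  using s
proof (induction n arbitrary: s)
  case (Suc n)
  have "w y * (jump_step (jump_law \<rho>) w ^^ n) (indicator A) (s + y) =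
    w y * (jump_step (jump_law \<rho>) w ^^ n) (indicator (A \<inter> log_rats)) (s + y)" for y
    using Suc.IH[of "s + y"] add_log_rats[of s y] Suc.prems w[of y] by (cases "y \<in> log_rats") auto
  thus ?case by (simp only: jump_step_funpow_Suc)
qed (auto simp: indicator_def)

lemma emeasure_cpoisson_supported:
  assumes [measurable]: "w \<in> borel_measurable borel" "A \<in> sets borel" and w: "\<And>y. y \<notin> log_rats \<Longrightarrow> w y = 0"
  shows "emeasure (cpoisson d (jump_law \<rho>) w) A = emeasure (cpoisson d (jump_law \<rho>) w) (A \<inter> log_rats)"
proof -
  let ?N = "measure_pmf (poisson_pmf d)" and ?U = "jump_step (jump_law \<rho>) w"
  have "emeasure (cpoisson d (jump_law \<rho>) w) A = (\<integral>\<^sup>+n. (?U ^^ n) (indicator A) 0 \<partial>?N)"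
    by (rule J.emeasure_cpoisson) auto
  also have "\<dots> = (\<integral>\<^sup>+n. (?U ^^ n) (indicator (A \<inter> log_rats)) 0 \<partial>?N)"
    by (intro nn_integral_cong jump_step_supported w zero_in_log_rats)
  also have "\<dots> = emeasure (cpoisson d (jump_law \<rho>) w) (A \<inter> log_rats)"
    by (rule J.emeasure_cpoisson[symmetric]) auto
  finally show ?thesis .
qed

text \<open>The left-hand side is the probability that all jumps lie in the group.\<close>

lemma measure_log_rats_ge:
  "exp (d * (measure \<rho> log_rats - 1)) \<le> measure \<rho> log_rats"
proof -
  let ?w = "indicator log_rats :: real \<Rightarrow> ennreal"
  have "(\<integral>\<^sup>+y. ?w y \<partial>jump_law \<rho>) = ennreal (measure \<rho> log_rats)"
    using emeasure_jump_law_invariant[of log_rats] by (simp add: emeasure_eq_measure)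
  hence "ennreal (exp (d * (measure \<rho> log_rats - 1))) = emeasure (cpoisson d (jump_law \<rho>) ?w) UNIV"
    by (subst J.emeasure_cpoisson_UNIV[OF d_pos]) auto
  also have "\<dots> = emeasure (cpoisson d (jump_law \<rho>) ?w) log_rats"
    by (subst emeasure_cpoisson_supported) auto
  also have "\<dots> \<le> emeasure (cpoisson d (jump_law \<rho>) (\<lambda>_. 1)) log_rats"
    by (rule J.emeasure_cpoisson_mono) (auto simp: indicator_def)
  also have "\<dots> = ennreal (measure \<rho> log_rats)"
    using fixed_point emeasure_eq_measure by simp
  finally show ?thesis by simp
qed

lemma measure_log_rats_subcritical:
  assumes "d \<le> 1"
  shows "measure \<rho> log_rats = 1"
proof (rule ccontr)
  let ?r = "measure \<rho> log_rats"
  assume "?r \<noteq> 1"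
  hence r: "?r < 1" using prob_le_1[of log_rats] by linarith
  have "?r = 1 + (?r - 1)" by simp
  also have "\<dots> < exp (?r - 1)" using r exp_minus_greater[of "1 - ?r"] by simp
  also have "\<dots> \<le> exp (d * (?r - 1))" using assms r mult_right_mono[of d 1 "1 - ?r"] by (simp add: algebra_simps)
  also have "\<dots> \<le> ?r" by (rule measure_log_rats_ge)
  finally show False by simp
qed

text \<open>A jump that is to lead from \<open>s\<close> to \<open>x\<close> has a prescribed sign, which costs the factor \<open>1/2\<close>, and
a prescribed absolute value, which determines the log-odds that cause it. This factor turns the
mean number \<open>d\<close> of jumps into the contraction rate \<open>d / 2\<close>.\<close>

lemma jump_step_indicator_singleton_le:
  assumes [measurable]: "H \<in> borel_measurable borel" and H: "\<And>u. H u * emeasure \<rho> {u} \<le> C"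
  shows "jump_step (jump_law \<rho>) (\<lambda>y. H (inv_surprisal \<bar>y\<bar>)) (indicator {x}) s \<le> ennreal (1 / 2) * C"
proof -
  define u where "u = inv_surprisal \<bar>x - s\<bar>"
  have eq: "jump_step (jump_law \<rho>) (\<lambda>y. H (inv_surprisal \<bar>y\<bar>)) (indicator {x}) s =
     ennreal (1 / 2) * (\<integral>\<^sup>+v. H v * indicator {x} (s + surprisal v) \<partial>\<rho>) +
     ennreal (1 / 2) * (\<integral>\<^sup>+v. H v * indicator {x} (s - surprisal v) \<partial>\<rho>)"
    using surprisal_pos by (simp add: jump_step_def nn_integral_jump_law abs_of_pos)
  have u1: "v = u" if "x = s + surprisal v" for v
  proof -
    have "\<bar>x - s\<bar> = surprisal v" using that surprisal_pos[of v] by simp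
    thus ?thesis by (simp add: u_def)
  qed
  have u2: "v = u" if "x = s - surprisal v" for v
  proof -
    have "\<bar>x - s\<bar> = surprisal v" using that surprisal_pos[of v] by simp
    thus ?thesis by (simp add: u_def)
  qed
  have le: "(\<integral>\<^sup>+v. H v * indicator {u} v \<partial>\<rho>) \<le> C" using H by simp
  show ?thesis
  proof (cases "s < x")
    case True
    hence "indicator {x} (s - surprisal v) = (0 :: ennreal)" for v
      using surprisal_pos[of v] by (auto simp: indicator_def)
    moreover have "(\<integral>\<^sup>+v. H v * indicator {x} (s + surprisal v) \<partial>\<rho>) \<le> (\<integral>\<^sup>+v. H v * indicator {u} v \<partial>\<rho>)"
      by (intro nn_integral_mono mult_left_mono) (auto simp: indicator_def dest: u1)
    ultimately show ?thesis unfolding eq using le by (simp add: mult_left_mono)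
  next
    case False
    hence "indicator {x} (s + surprisal v) = (0 :: ennreal)" for v
      using surprisal_pos[of v] by (auto simp: indicator_def)
    moreover have "(\<integral>\<^sup>+v. H v * indicator {x} (s - surprisal v) \<partial>\<rho>) \<le> (\<integral>\<^sup>+v. H v * indicator {u} v \<partial>\<rho>)"
      by (intro nn_integral_mono mult_left_mono) (auto simp: indicator_def dest: u2)
    ultimately show ?thesis unfolding eq using le by (simp add: mult_left_mono)
  qed
qed

lemma inv_surprisal_abs_notin_log_rats:
  assumes "y \<notin> log_rats"
  shows "inv_surprisal \<bar>y\<bar> \<notin> log_rats"
proof -
  have "y \<noteq> 0" using assms by auto
  hence "surprisal (inv_surprisal \<bar>y\<bar>) = \<bar>y\<bar>" by (simp add: surprisal_inv_surprisal)
  moreover have "\<bar>y\<bar> \<notin> log_rats" using assms by (cases "0 \<le> y") auto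
  ultimately show ?thesis by (metis surprisal_log_rats)
qed

text \<open>Here \<open>g x\<close> plays the role of the probability, given the log-odds \<open>x\<close>, that the tree generating
them has height less than \<open>l\<close>. In the induction step, a tree is accepted if all its subtrees
are accepted: the new weight is the quotient of the atom of the weighted compound Poisson law and
the atom of \<open>\<rho>\<close>. The mass \<open>m\<close> of the accepted trees then turns into at most \<open>exp (d (m - 1))\<close>, so
that any \<open>q\<close> with \<open>exp (d (q - 1)) \<le> q\<close> remains an upper bound.\<close>

lemma finite_tree_weights:
  assumes q: "0 \<le> q" "q \<le> 1" "exp (d * (q - 1)) \<le> q"
  shows "\<exists>g\<in>borel_measurable borel. (\<forall>x. g x \<le> 1) \<and> (\<forall>x. x \<notin> log_rats \<longrightarrow> g x = 0) \<and>
    (\<forall>x. emeasure \<rho> {x} \<le> g x * emeasure \<rho> {x} + ennreal ((d / 2) ^ l)) \<and>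
    (\<integral>\<^sup>+x. g x \<partial>\<rho>) \<le> ennreal q"
proof (induction l)
  case 0
  show ?case by (rule bexI[of _ "\<lambda>_. 0"]) (auto simp: measure_le_1 emeasure_le_1)
next
  case (Suc l)
  then obtain g where g [measurable]: "g \<in> borel_measurable borel" and g1: "\<And>x. g x \<le> 1"
    and g0: "\<And>x. x \<notin> log_rats \<Longrightarrow> g x = 0"
    and gl: "\<And>x. emeasure \<rho> {x} \<le> g x * emeasure \<rho> {x} + ennreal ((d / 2) ^ l)"
    and gq: "(\<integral>\<^sup>+x. g x \<partial>\<rho>) \<le> ennreal q" by auto
  define w where "w = (\<lambda>y. g (inv_surprisal \<bar>y\<bar>))"
  define h where "h = (\<lambda>y. 1 - g (inv_surprisal \<bar>y\<bar>))"
  have [measurable]: "w \<in> borel_measurable borel" "h \<in> borel_measurable borel"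
    unfolding w_def h_def by measurable
  have w0: "w y = 0" if "y \<notin> log_rats" for y
    using inv_surprisal_abs_notin_log_rats[OF that] by (simp add: w_def g0)
  have w1: "w y \<le> 1" for y using g1 by (simp add: w_def)
  have wh: "w y + h y = 1" for y unfolding w_def h_def using g1 by (intro add_diff_inverse_ennreal) auto
  define c where "c = (\<lambda>x. emeasure (cpoisson d (jump_law \<rho>) w) {x})"
  have c_le: "c x \<le> emeasure \<rho> {x}" for x
    unfolding c_def by (subst (2) fixed_point, rule J.emeasure_cpoisson_mono) (use w1 in auto)
  have c0: "c x = 0" if "x \<notin> log_rats" for x
    unfolding c_def using that by (subst emeasure_cpoisson_supported[OF _ _ w0]) auto
  have bound: "emeasure \<rho> {x} \<le> c x + ennreal ((d / 2) ^ Suc l)" for x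
  proof -
    have hl: "(1 - g u) * emeasure \<rho> {u} \<le> ennreal ((d / 2) ^ l)" for u
    proof -
      have "g u * emeasure \<rho> {u} + (1 - g u) * emeasure \<rho> {u} = emeasure \<rho> {u}"
        using g1[of u] by (simp add: distrib_right[symmetric] add_diff_inverse_ennreal)
      hence "g u * emeasure \<rho> {u} + (1 - g u) * emeasure \<rho> {u} \<le> g u * emeasure \<rho> {u} + ennreal ((d / 2) ^ l)"
        using gl[of u] by simp
      moreover have "g u * emeasure \<rho> {u} \<noteq> \<infinity>"
        using g1[of u] by (auto simp: ennreal_mult_eq_top_iff top_unique)
      ultimately show ?thesis by (simp add: ennreal_add_left_cancel_le)
    qed
    have "jump_step (jump_law \<rho>) h (indicator {x}) s \<le> ennreal (1 / 2) * ennreal ((d / 2) ^ l)" for s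
      unfolding h_def by (rule jump_step_indicator_singleton_le[of "\<lambda>u. 1 - g u"]) (use hl in auto)
    hence "emeasure (cpoisson d (jump_law \<rho>) (\<lambda>_. 1)) {x} \<le> c x + ennreal d * (ennreal (1 / 2) * ennreal ((d / 2) ^ l))"
      unfolding c_def by (intro J.emeasure_cpoisson_thinning_bound[where h=h] d_pos wh) auto
    moreover have "ennreal ((d / 2) ^ Suc l) = ennreal d * (ennreal (1 / 2) * ennreal ((d / 2) ^ l))"
    proof -
      have "ennreal ((d / 2) ^ Suc l) = ennreal (d * (1 / 2 * (d / 2) ^ l))" by simp
      also have "\<dots> = ennreal d * ennreal (1 / 2 * (d / 2) ^ l)"
        by (rule ennreal_mult) (use d_pos in auto)
      also have "ennreal (1 / 2 * (d / 2) ^ l) = ennreal (1 / 2) * ennreal ((d / 2) ^ l)"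
        by (rule ennreal_mult) (use d_pos in auto)
      finally show ?thesis .
    qed
    ultimately show ?thesis using fixed_point by simp
  qed
  \<comment> \<open>The value \<open>0 / 0 = 0\<close> makes the weight vanish where \<open>\<rho>\<close> has no atom.\<close>
  define g' where "g' = (\<lambda>x. c x / emeasure \<rho> {x})"
  have g'0: "g' x = 0" if "x \<notin> log_rats" for x using c0[OF that] by (simp add: g'_def)
  have mg' [measurable]: "g' \<in> borel_measurable borel"
    by (rule measurable_discrete_difference[where X=log_rats and f="\<lambda>_. 0"]) (use countable_log_rats g'0 in auto)
  have g'c: "g' x * emeasure \<rho> {x} = c x" for x
  proof (cases "emeasure \<rho> {x} = 0")
    case True
    thus ?thesis using c_le[of x] by simp
  next
    case False
    thus ?thesis by (simp add: g'_def ennreal_divide_times emeasure_eq_measure)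
  qed
  have g'1: "g' x \<le> 1" for x
    using c_le[of x] by (cases "emeasure \<rho> {x} = 0") (auto simp: g'_def zero_less_iff_neq_zero intro!: divide_le_posI_ennreal)
  have "(\<integral>\<^sup>+x. g' x \<partial>\<rho>) = (\<integral>\<^sup>+x. g' x * emeasure \<rho> {x} \<partial>count_space log_rats)"
    by (rule nn_integral_countable_support) (use g'0 countable_log_rats in auto)
  also have "\<dots> = emeasure (cpoisson d (jump_law \<rho>) w) log_rats"
    unfolding g'c c_def by (rule emeasure_countable_singleton[symmetric]) (use countable_log_rats in auto)
  also have "\<dots> \<le> emeasure (cpoisson d (jump_law \<rho>) w) UNIV"
    by (rule emeasure_mono) auto
  also have "\<dots> \<le> ennreal q"
  proof -
    define r where "r = enn2real (\<integral>\<^sup>+x. g x \<partial>\<rho>)"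
    have fin: "(\<integral>\<^sup>+x. g x \<partial>\<rho>) < top" using gq by (rule le_less_trans) simp
    have r: "(\<integral>\<^sup>+x. g x \<partial>\<rho>) = ennreal r" unfolding r_def using fin by simp
    have r0: "0 \<le> r" and rq: "r \<le> q" using gq q unfolding r by (auto simp: r_def)
    have "(\<integral>\<^sup>+y. w y \<partial>jump_law \<rho>) = ennreal (1 / 2) * ennreal r + ennreal (1 / 2) * ennreal r"
      unfolding r[symmetric] by (subst nn_integral_jump_law) (auto simp: w_def surprisal_pos abs_of_pos)
    also have "\<dots> = ennreal r" by (rule ennreal_half_plus_half)
    finally have "emeasure (cpoisson d (jump_law \<rho>) w) UNIV = ennreal (exp (d * (r - 1)))"
      using r0 rq q by (intro J.emeasure_cpoisson_UNIV[OF d_pos]) auto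
    also have "\<dots> \<le> ennreal (exp (d * (q - 1)))"
      using rq d_pos by (intro ennreal_leI) (simp add: mult_left_mono)
    also have "\<dots> \<le> ennreal q" using q by (intro ennreal_leI) auto
    finally show ?thesis .
  qed
  finally have "(\<integral>\<^sup>+x. g' x \<partial>\<rho>) \<le> ennreal q" .
  thus ?case using g'1 g'0 bound by (intro bexI[of _ g'] mg') (auto simp: g'c)
qed

text \<open>The weights vanish at \<open>x\<close>, so that the atom at \<open>x\<close> is bounded by their error.\<close>

lemma atom_imp_log_rats:
  assumes "d < 2" "x \<notin> log_rats"
  shows "emeasure \<rho> {x} = 0"
proof -
  have "measure \<rho> {x} \<le> (d / 2) ^ l" for l
  proof -
    obtain g :: "real \<Rightarrow> ennreal" where "\<And>y. y \<notin> log_rats \<Longrightarrow> g y = 0"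
      and g: "\<And>y. emeasure \<rho> {y} \<le> g y * emeasure \<rho> {y} + ennreal ((d / 2) ^ l)"
      using finite_tree_weights[of 1 l] by auto
    hence "g x = 0" using assms(2) by simp
    thus ?thesis using g[of x] d_pos by (simp add: emeasure_eq_measure)
  qed
  moreover have "(\<lambda>l. (d / 2) ^ l) \<longlonglongrightarrow> 0" using assms d_pos by (intro LIMSEQ_realpow_zero) auto
  ultimately have "measure \<rho> {x} \<le> 0" by (intro LIMSEQ_le_const) auto
  thus ?thesis using measure_nonneg[of \<rho> "{x}"] by (simp add: emeasure_eq_measure)
qed

text \<open>On a finite set, the atoms are approximated by their weighted versions, whose sum is at most
\<open>q\<close>. Finite sets exhaust the countable group.\<close>

lemma measure_log_rats_le:
  assumes d2: "d < 2" and q: "0 \<le> q" "q \<le> 1" "exp (d * (q - 1)) \<le> q"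
  shows "measure \<rho> log_rats \<le> q"
proof -
  have fin: "measure \<rho> F \<le> q" if F: "finite F" "F \<subseteq> log_rats" for F
  proof -
    have "measure \<rho> F \<le> q + real (card F) * (d / 2) ^ l" for l
    proof -
      obtain g where [measurable]: "g \<in> borel_measurable borel"
        and gl: "\<And>x. emeasure \<rho> {x} \<le> g x * emeasure \<rho> {x} + ennreal ((d / 2) ^ l)"
        and gq: "(\<integral>\<^sup>+x. g x \<partial>\<rho>) \<le> ennreal q"
        using finite_tree_weights[OF q, of l] by blast
      have "emeasure \<rho> F = (\<Sum>x\<in>F. emeasure \<rho> {x})"
        by (rule emeasure_eq_sum_singleton) (use F in auto)
      also have "\<dots> \<le> (\<Sum>x\<in>F. g x * emeasure \<rho> {x} + ennreal ((d / 2) ^ l))"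
        by (intro sum_mono gl)
      also have "\<dots> = (\<Sum>x\<in>F. \<integral>\<^sup>+y. g y * indicator {x} y \<partial>\<rho>) + of_nat (card F) * ennreal ((d / 2) ^ l)"
        by (simp add: sum.distrib)
      also have "(\<Sum>x\<in>F. \<integral>\<^sup>+y. g y * indicator {x} y \<partial>\<rho>) = (\<integral>\<^sup>+y. (\<Sum>x\<in>F. g y * indicator {x} y) \<partial>\<rho>)"
        by (rule nn_integral_sum[symmetric]) auto
      also have "\<dots> \<le> (\<integral>\<^sup>+y. g y \<partial>\<rho>)"
      proof (intro nn_integral_mono)
        fix y
        have "(\<Sum>x\<in>F. g y * indicator {x} y) = (\<Sum>x\<in>F. if x = y then g y else 0)"
          by (intro sum.cong) (auto simp: indicator_def)
        also have "\<dots> \<le> g y" using F(1) by simp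
        finally show "(\<Sum>x\<in>F. g y * indicator {x} y) \<le> g y" .
      qed
      also note gq
      finally have "emeasure \<rho> F \<le> ennreal q + of_nat (card F) * ennreal ((d / 2) ^ l)"
        by (simp add: add_right_mono)
      also have "\<dots> = ennreal (q + real (card F) * (d / 2) ^ l)"
        using q d_pos by (simp add: ennreal_of_nat_eq_real_of_nat flip: ennreal_mult ennreal_plus)
      finally have "ennreal (measure \<rho> F) \<le> ennreal (q + real (card F) * (d / 2) ^ l)"
        by (simp only: emeasure_eq_measure)
      thus ?thesis using q d_pos by (subst (asm) ennreal_le_iff) auto
    qed
    moreover have "(\<lambda>l. q + real (card F) * (d / 2) ^ l) \<longlonglongrightarrow> q + real (card F) * 0"
      using d2 d_pos by (intro tendsto_intros LIMSEQ_realpow_zero) auto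
    ultimately show ?thesis by (intro LIMSEQ_le_const) auto
  qed
  define F where "F = (\<lambda>n. from_nat_into log_rats ` {..n})"
  have ne: "log_rats \<noteq> {}" using zero_in_log_rats by blast
  have sub: "F n \<subseteq> log_rats" for n unfolding F_def using from_nat_into[OF ne] by auto
  have U: "(\<Union>n. F n) = log_rats"
  proof -
    have "(\<Union>n. F n) = range (from_nat_into log_rats)" by (auto simp: F_def)
    thus ?thesis using range_from_nat_into[OF ne countable_log_rats] by simp
  qed
  have "(\<lambda>n. measure \<rho> (F n)) \<longlonglongrightarrow> measure \<rho> (\<Union>n. F n)"
    by (rule finite_Lim_measure_incseq) (auto simp: F_def incseq_def intro!: borel_closed finite_imp_closed)
  thus ?thesis unfolding U by (rule LIMSEQ_le_const2) (use fin sub in \<open>auto simp: F_def\<close>)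
qed

text \<open>For \<open>d > 1\<close> the value \<open>q = 1 / d < 1\<close> is admissible, as \<open>d \<le> exp (d - 1)\<close>.\<close>

lemma measure_log_rats_supercritical:
  assumes "1 < d" "d < 2"
  shows "measure \<rho> log_rats < 1"
proof -
  have "d \<le> exp (d - 1)" using exp_ge_add_one_self[of "d - 1"] by simp
  hence "inverse (exp (d - 1)) \<le> inverse d" using assms by (intro le_imp_inverse_le) auto
  moreover have "d * (1 / d - 1) = - (d - 1)" using assms by (simp add: field_simps)
  ultimately have "exp (d * (1 / d - 1)) \<le> 1 / d"
    by (simp only: exp_minus) (simp add: divide_inverse)
  hence "measure \<rho> log_rats \<le> 1 / d" using assms by (intro measure_log_rats_le) auto
  also have "\<dots> < 1" using assms by simp
  finally show ?thesis .
qed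

text \<open>Two jumps suffice. The translates of the interval by the elements of the dense group cover the line,
and they are countably many, so one of them carries part of the diffuse mass of the jump law; the
other jump provides the translation, which has to be non-zero because jumps are.\<close>

lemma full_support_off_log_rats:
  assumes r: "measure \<rho> log_rats < 1" and uv: "u < v"
  shows "0 < emeasure \<rho> ({u<..<v} - log_rats)"
proof -
  have c [measurable]: "- log_rats \<in> sets borel" by (rule borel_comp) simp
  let ?\<nu> = "jump_law \<rho>" and ?I = "{u<..<v} - log_rats"
  let ?B = "\<lambda>y. {z. y + z \<in> ?I}"
  have [measurable]: "?B y \<in> sets borel" for y by measurable
  have \<nu>: "emeasure ?\<nu> (- log_rats) = emeasure \<rho> (- log_rats)"
    by (rule emeasure_jump_law_invariant) auto
  have "measure \<rho> (- log_rats) = 1 - measure \<rho> log_rats"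
    using prob_compl[of log_rats] by (simp add: Compl_eq_Diff_UNIV)
  hence "0 < emeasure \<rho> (- log_rats)" using r by (simp add: emeasure_eq_measure)
  hence \<nu>pos: "emeasure ?\<nu> (- log_rats) \<noteq> 0" unfolding \<nu> by simp
  \<comment> \<open>Otherwise the jump law would give no mass to the complement of the group.\<close>
  have "\<exists>y\<in>log_rats - {0}. emeasure ?\<nu> (?B y) \<noteq> 0"
  proof (rule ccontr)
    assume "\<not> ?thesis"
    hence "?B y \<in> null_sets ?\<nu>" if "y \<in> log_rats - {0}" for y using that by auto
    hence "(\<Union>y\<in>log_rats - {0}. ?B y) \<in> null_sets ?\<nu>"
      by (intro null_sets_UN') (use countable_log_rats in auto)
    moreover have "- log_rats \<subseteq> (\<Union>y\<in>log_rats - {0}. ?B y)"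
    proof
      fix z assume z: "z \<in> - log_rats"
      obtain y where "y \<in> log_rats" "u - z < y" "y < v - z" "y \<noteq> 0"
        using log_rats_dense[of "u - z" "v - z"] uv by auto
      thus "z \<in> (\<Union>y\<in>log_rats - {0}. ?B y)"
        using z by (auto simp: add_log_rats_iff intro!: bexI[of _ y])
    qed
    ultimately have "- log_rats \<in> null_sets ?\<nu>"
      by (metis null_sets_subset c J.events_eq_borel)
    thus False using \<nu>pos by auto
  qed
  then obtain y where y: "y \<in> log_rats" "y \<noteq> 0" and By: "0 < emeasure ?\<nu> (?B y)" by (auto simp: zero_less_iff_neq_zero)
  have \<nu>y: "0 < emeasure ?\<nu> {y}"
  proof -
    define x where "x = inv_surprisal \<bar>y\<bar>"
    have sx: "surprisal x = \<bar>y\<bar>" unfolding x_def using y by (intro surprisal_inv_surprisal) auto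
    have "\<bar>y\<bar> \<in> log_rats" using y by (cases "0 \<le> y") auto
    hence "x \<in> log_rats" using sx surprisal_log_rats by metis
    hence "0 < ennreal (1 / 2) * emeasure \<rho> {x}" using log_rats_atom by (intro ennreal_half_mult_pos)
    also have "\<dots> \<le> emeasure ?\<nu> {y}"
      using jump_law_singleton[of x] sx by (cases "0 \<le> y") auto
    finally show ?thesis .
  qed
  have "emeasure ?\<nu> {y} * emeasure ?\<nu> (?B y) = (\<integral>\<^sup>+x. emeasure ?\<nu> (?B y) * indicator {y} x \<partial>?\<nu>)"
    by (subst nn_integral_indicator_singleton) (simp_all add: mult.commute)
  also have "\<dots> \<le> (\<integral>\<^sup>+x. \<integral>\<^sup>+z. indicator ?I (x + z) \<partial>?\<nu> \<partial>?\<nu>)"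
  proof (intro nn_integral_mono)
    fix x
    have "emeasure ?\<nu> (?B y) = (\<integral>\<^sup>+z. indicator (?B y) z \<partial>?\<nu>)" by simp
    also have "\<dots> = (\<integral>\<^sup>+z. indicator ?I (y + z) \<partial>?\<nu>)" by (intro nn_integral_cong) (auto simp: indicator_def)
    finally show "emeasure ?\<nu> (?B y) * indicator {y} x \<le> (\<integral>\<^sup>+z. indicator ?I (x + z) \<partial>?\<nu>)"
      by (auto simp: indicator_def)
  qed
  also have "\<dots> = (jump_step ?\<nu> (\<lambda>_. 1) ^^ 2) (indicator ?I) 0"
    by (simp add: jump_step_def numeral_2_eq_2)
  finally have "0 < (jump_step ?\<nu> (\<lambda>_. 1) ^^ 2) (indicator ?I) 0"
    using \<nu>y By by (metis ennreal_zero_less_mult_iff less_le_trans)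
  hence "0 < ennreal (pmf (poisson_pmf d) 2) * (jump_step ?\<nu> (\<lambda>_. 1) ^^ 2) (indicator ?I) 0"
    using poisson_pmf_pos[of 2] by (simp only: ennreal_zero_less_mult_iff)
  also have "\<dots> \<le> emeasure \<rho> ?I" by (rule fixed_point_ge_term) measurable
  finally show ?thesis .
qed

end

section \<open>The pure point support and the continuous part of the marginal distribution\<close>

lemma logit_log_rats_iff:
  assumes "0 < x" "x < 1"
  shows "logit x \<in> log_rats \<longleftrightarrow> x \<in> \<rat>"
proof -
  have "logit x \<in> log_rats \<longleftrightarrow> surprisal (logit x) \<in> log_rats" by simp
  also have "\<dots> \<longleftrightarrow> ln x \<in> log_rats" using assms by (simp add: surprisal_logit)
  finally show ?thesis using assms by (simp add: log_rats_def)
qed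

lemma logit_less_iff:
  assumes "0 < x" "x < 1" "0 < y" "y < 1"
  shows "logit x < logit y \<longleftrightarrow> x < y"
  using assms by (simp add: logit_def field_simps)

theorem theorem1p3:
  fixes d :: real and \<pi> :: "real measure"
  assumes "0 < d" and "d < 2"
    and "prob_space \<pi>" and "sets \<pi> = sets borel" and "emeasure \<pi> {0..1} = 1"
    and "empirical_marginals_converge d \<pi>"
    and "BP_limit d \<pi>"
  shows "pure_point_support \<pi> = \<rat> \<inter> {0<..<1} \<and>
    (d \<le> 1 \<longrightarrow> discrete_measure \<pi>) \<and>
    (1 < d \<longrightarrow> nontrivial (continuous_part \<pi>) \<and> supp (continuous_part \<pi>) = {0..1})"
proof -
  have u: "unit_law \<pi>" by (rule unit_law_BP_limit) fact+
  interpret \<pi>: real_distribution \<pi> using u by (simp add: unit_law_def)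
  define \<rho> where "\<rho> = distr \<pi> borel logit"
  note fp = log_odds_law_fixed_point[OF assms(1,2) u assms(7), folded \<rho>_def]
  interpret \<rho>: log_odds_fixed_point \<rho> d
    using fp assms(1) by (simp add: log_odds_fixed_point_def log_odds_fixed_point_axioms_def)
  have AE01: "AE x in \<pi>. 0 < x \<and> x < 1" using u by (simp add: unit_law_def)
  have transfer: "emeasure \<pi> A = emeasure \<rho> B"
    if [measurable]: "A \<in> sets borel" "B \<in> sets borel" and AB: "\<And>x. 0 < x \<Longrightarrow> x < 1 \<Longrightarrow> x \<in> A \<longleftrightarrow> logit x \<in> B" for A B
  proof -
    have "emeasure \<rho> B = emeasure \<pi> (logit -` B \<inter> space \<pi>)"
      unfolding \<rho>_def by (rule emeasure_distr) auto
    also have "\<dots> = emeasure \<pi> A"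
    proof (rule emeasure_eq_AE)
      show "AE x in \<pi>. x \<in> logit -` B \<inter> space \<pi> \<longleftrightarrow> x \<in> A"
        using AE01 by eventually_elim (use AB in auto)
      show "logit -` B \<inter> space \<pi> \<in> sets \<pi>" by (rule measurable_sets[of _ _ borel]) auto
    qed auto
    finally show ?thesis ..
  qed
  have single: "emeasure \<pi> {x} = emeasure \<rho> {logit x}" if "0 < x" "x < 1" for x
  proof (rule transfer)
    fix y :: real assume "0 < y" "y < 1"
    thus "y \<in> {x} \<longleftrightarrow> logit y \<in> {logit x}"
      using logit_less_iff[of x y] logit_less_iff[of y x] that by (metis less_irrefl linorder_less_linear singleton_iff)
  qed auto
  have outside: "emeasure \<pi> {x} = 0" if "\<not> (0 < x \<and> x < 1)" for x
  proof -
    have "emeasure \<pi> {x} = emeasure \<rho> {}" by (rule transfer) (use that in auto)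
    thus ?thesis by simp
  qed
  have atom: "0 < emeasure \<pi> {x} \<longleftrightarrow> x \<in> \<rat> \<inter> {0<..<1}" for x
  proof (cases "0 < x \<and> x < 1")
    case True
    have "0 < emeasure \<pi> {x} \<longleftrightarrow> logit x \<in> log_rats"
      using single[of x] True \<rho>.log_rats_atom \<rho>.atom_imp_log_rats[OF assms(2)] by force
    thus ?thesis using logit_log_rats_iff True by auto
  qed (use outside in auto)
  have mR [measurable]: "\<rat> \<in> sets (borel :: real measure)"
    using countable_rat by (rule sets.countable[rotated]) simp
  have 1: "pure_point_support \<pi> = \<rat> \<inter> {0<..<1}"
    unfolding pure_point_support_def atom by auto
  have 2: "discrete_measure \<pi>" if "d \<le> 1"
  proof -
    have "emeasure \<pi> (- \<rat>) = emeasure \<rho> (- log_rats)"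
      by (rule transfer) (auto simp: logit_log_rats_iff intro: borel_comp)
    also have "\<dots> = 0"
      using \<rho>.measure_log_rats_subcritical[OF that] \<rho>.prob_compl[of log_rats]
      by (simp add: \<rho>.emeasure_eq_measure Compl_eq_Diff_UNIV)
    finally show ?thesis unfolding discrete_measure_def
      by (intro exI[of _ \<rat>]) (auto simp: countable_rat Compl_eq_Diff_UNIV)
  qed
  have 3: "nontrivial (continuous_part \<pi>) \<and> supp (continuous_part \<pi>) = {0..1}" if d1: "1 < d"
  proof -
    define \<gamma> where "\<gamma> = continuous_part \<pi>"
    obtain \<alpha> where dec: "decomposition \<pi> \<alpha> \<gamma>"
      using decomposition_continuous_part[of \<pi>] \<pi>.finite_measure_axioms assms(4) unfolding \<gamma>_def by blast
    have s [measurable_cong]: "sets \<alpha> = sets borel" "sets \<gamma> = sets borel" using dec assms(4) by (simp_all add: decomposition_def)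
    have sp: "space \<alpha> = UNIV" "space \<gamma> = UNIV" using s[THEN sets_eq_imp_space_eq] by auto
    have add: "emeasure \<pi> A = emeasure \<alpha> A + emeasure \<gamma> A" if "A \<in> sets borel" for A
      using dec that assms(4) by (simp add: decomposition_def)
    obtain C where C: "countable C" "C \<in> sets borel" "emeasure \<alpha> (UNIV - C) = 0"
      using dec sp s by (auto simp: decomposition_def discrete_measure_def)
    \<comment> \<open>The discrete part is carried by the atoms of \<open>\<pi>\<close>, so irrational points belong to \<open>\<gamma>\<close>.\<close>
    have \<alpha>0: "emeasure \<alpha> (- \<rat>) = 0"
    proof -
      have "{x} \<in> null_sets \<alpha>" if "x \<in> C - \<rat>" for x
      proof -
        have "emeasure \<pi> {x} = 0" using atom[of x] that by (auto simp: zero_less_iff_neq_zero)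
        thus ?thesis using add[of "{x}"] s by (auto simp: null_sets_def)
      qed
      hence "(\<Union>x\<in>C - \<rat>. {x}) \<in> null_sets \<alpha>" using C(1) by (intro null_sets_UN') auto
      hence n: "C - \<rat> \<in> null_sets \<alpha>" by simp
      have "UNIV - C \<in> null_sets \<alpha>" using C s by (auto simp: null_sets_def)
      hence "(C - \<rat>) \<union> (UNIV - C) \<in> null_sets \<alpha>" using n by (rule null_sets.Un[rotated])
      hence "- \<rat> \<in> null_sets \<alpha>"
        by (rule null_sets_subset) (auto simp: s intro: borel_comp)
      thus ?thesis by auto
    qed
    have pos: "0 < emeasure \<gamma> ({a<..<b} \<inter> {0..1})" if ab: "0 \<le> a" "a < b" "b \<le> 1" for a b
    proof -
      \<comment> \<open>The strict subinterval keeps the log-odds of its ends finite.\<close>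
      define a' where "a' = (2 * a + b) / 3"
      define b' where "b' = (a + 2 * b) / 3"
      have ab': "a < a'" "a' < b'" "b' < b" using ab by (auto simp: a'_def b'_def)
      have "0 < emeasure \<rho> ({logit a'<..<logit b'} - log_rats)"
        using ab ab' by (intro \<rho>.full_support_off_log_rats \<rho>.measure_log_rats_supercritical d1 assms(2))
          (auto simp: logit_less_iff)
      also have "\<dots> = emeasure \<pi> ({a'<..<b'} - \<rat>)"
      proof (rule transfer[symmetric])
        fix x :: real assume "0 < x" "x < 1"
        thus "x \<in> {a'<..<b'} - \<rat> \<longleftrightarrow> logit x \<in> {logit a'<..<logit b'} - log_rats"
          using ab ab' by (auto simp: logit_less_iff logit_log_rats_iff)
      qed auto
      also have "\<dots> = emeasure \<alpha> ({a'<..<b'} - \<rat>) + emeasure \<gamma> ({a'<..<b'} - \<rat>)" by (rule add) auto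
      also have "emeasure \<alpha> ({a'<..<b'} - \<rat>) = 0"
      proof -
        have "emeasure \<alpha> ({a'<..<b'} - \<rat>) \<le> emeasure \<alpha> (- \<rat>)"
          by (rule emeasure_mono) (auto simp: s intro: borel_comp)
        thus ?thesis using \<alpha>0 by simp
      qed
      also have "0 + emeasure \<gamma> ({a'<..<b'} - \<rat>) \<le> emeasure \<gamma> ({a<..<b} \<inter> {0..1})"
        using ab ab' by (simp, intro emeasure_mono) (auto simp: s)
      finally show ?thesis .
    qed
    have "0 < emeasure \<gamma> ({0<..<1} \<inter> {0..1})" by (rule pos) auto
    also have "\<dots> \<le> emeasure \<gamma> (space \<gamma>)" by (rule emeasure_space)
    finally have "nontrivial \<gamma>" by (simp add: nontrivial_def)
    moreover have "x \<in> supp \<gamma>" if x: "x \<in> {0..1}" for x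
      unfolding supp_def
    proof (intro CollectI conjI allI impI x)
      fix \<epsilon> :: real assume e: "0 < \<epsilon>"
      define a where "a = max 0 (x - \<epsilon>)"
      define b where "b = min 1 (x + \<epsilon>)"
      have "0 < emeasure \<gamma> ({a<..<b} \<inter> {0..1})" using x e by (intro pos) (auto simp: a_def b_def)
      also have "\<dots> \<le> emeasure \<gamma> ({x - \<epsilon><..<x + \<epsilon>} \<inter> {0..1})"
        by (intro emeasure_mono) (auto simp: s a_def b_def)
      finally show "0 < emeasure \<gamma> ({x - \<epsilon><..<x + \<epsilon>} \<inter> {0..1})" .
    qed
    hence "supp \<gamma> = {0..1}" by (auto simp: supp_def)
    ultimately show ?thesis by (simp add: \<gamma>_def)
  qed
  show ?thesis using 1 2 3 by blast
qed

end
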